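(* Consider the four problems (Weihrauch degrees) $\mathsf{SRT}^2_2 \sqcup \mathsf{COH}$, $\mathsf{RT}^2_2$, $\mathsf{SRT}^2_2 \times \mathsf{COH}$, and $\mathsf{SRT}^2_2 \star \mathsf{COH}$. No Weihrauch reductions hold between them other than the reductions $$\mathsf{SRT}^2_2 \sqcup \mathsf{COH} \leq_{W} \mathsf{RT}^2_2 \leq_{W} \mathsf{SRT}^2_2 \star \mathsf{COH}, \qquad \mathsf{SRT}^2_2 \sqcup \mathsf{COH} \leq_{W} \mathsf{SRT}^2_2 \times \mathsf{COH} \leq_{W} \mathsf{SRT}^2_2 \star \mathsf{COH}$$ and those that follow from them by reflexivity and transitivity. That is: $\mathsf{RT}^2_2 \nleq_{W} \mathsf{SRT}^2_2 \times \mathsf{COH}$; $\mathsf{SRT}^2_2 \times \mathsf{COH} \nleq_{W} \mathsf{RT}^2_2$; neither $\mathsf{RT}^2_2$, nor $\mathsf{SRT}^2_2 \times \mathsf{COH}$, nor $\mathsf{SRT}^2_2 \star \mathsf{COH}$ is Weihrauch reducible to $\mathsf{SRT}^2_2 \sqcup \mathsf{COH}$; and $\mathsf{SRT}^2_2 \star \mathsf{COH}$ is Weihrauch reducible neither to $\mathsf{RT}^2_2$ nor to $\mathsf{SRT}^2_2 \times \mathsf{COH}$.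
   Context: A problem is a partial multifunction $\mathsf{P} : \subseteq 2^\omega \rightrightarrows 2^\omega$; elements $X \in \mathrm{dom}(\mathsf{P})$ are its instances, and elements of $\mathsf{P}(X)$ are the solutions to $X$. Colorings, pairs, numbers, etc. are coded as elements of $2^\omega$ in a standard way. $\mathsf{Q} \leq_{W} \mathsf{P}$ (Weihrauch reducibility) means there are Turing functionals $\Phi, \Psi$ such that for every instance $X$ of $\mathsf{Q}$, $\Phi^X$ is an instance of $\mathsf{P}$, and for every solution $\widehat{Y}$ to $\Phi^X$, $\Psi^{X \oplus \widehat{Y}}$ is a solution to $X$. Product $\mathsf{P}_0 \times \mathsf{P}_1$: instances are pairs $\langle X_0,X_1\rangle$ with $X_i$ a $\mathsf{P}_i$-instance; solutions are pairs $\langle Y_0,Y_1\rangle$ with $Y_i$ a $\mathsf{P}_i$-solution to $X_i$. Coproduct $\mathsf{P}_0 \sqcup \mathsf{P}_1$: instances are pairs $\langle i,X\rangle$ with $i<2$ and $X$ a $\mathsf{P}_i$-instance; solutions are the $\mathsf{P}_i$-solutions to $X$. Composition $\mathsf{P}_1 \circ \mathsf{P}_0$: instances are the $\mathsf{P}_0$-instances $X$ such that every $\mathsf{P}_0$-solution to $X$ is a $\mathsf{P}_1$-instance; solutions are the $\mathsf{P}_1$-solutions to the $\mathsf{P}_0$-solutions to $X$. Compositional product $\mathsf{P}_1 \star \mathsf{P}_0$: the Weihrauch degree $\max_{\leq_{W}}\{\mathsf{Q}_1 \circ \mathsf{Q}_0 : \mathsf{Q}_i \leq_{W} \mathsf{P}_i\}$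 (this maximum is known to exist). Write $[X]^2 = \{\langle x,y\rangle \in X\times X : x<y\}$ and $k=\{0,\dots,k-1\}$. A coloring $c:[\omega]^2\to k$ is stable if for every $x$, $\lim_y c(x,y)$ exists. A set $H$ is homogeneous for $c$ if $c$ is constant on $[H]^2$. $\mathsf{RT}^2_2$: instances are colorings $c:[\omega]^2\to 2$; solutions are infinite homogeneous sets for $c$. $\mathsf{SRT}^2_2$: the restriction of $\mathsf{RT}^2_2$ to stable colorings. $\mathsf{COH}$: instances are sequences $\langle c_0,c_1,\dots\rangle$ with $c_i:\omega\to 2$; solutions are infinite sets $X$ such that for each $i$ there is a finite set $F$ with $c_i$ constant on $X - F$. The four displayed reductions in the claim are known facts. *)

theory Defs
  imports Complex_Main "HOL-Library.Nat_Bijection" "HOL-Library.Ramsey"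
    "HOL-Library.Diagonal_Subsequence"
begin

section \<open>Turing functionals\<close>

text \<open>
  Elements of Cantor space are sets of natural numbers, identified with their characteristic
  functions. Turing functionals are presented by Kleene's schemes for partial recursive functions
  relativised to such a set: \<^term>\<open>eval A p xs\<close> below is the value on the arguments \<open>xs\<close> of
  the function with index \<open>p\<close> relative to \<open>A\<close>, where \<^term>\<open>None\<close> means divergence.
  The recursion variable of \<^term>\<open>Prec\<close> and the search variable of \<^term>\<open>Mu\<close> are the first
  argument. Arities are not enforced; superfluous arguments are ignored.
\<close>

type_synonym cantor = "nat set"

datatype prog =
    Zero
  | Succ
  | Query
  | Proj nat
  | Comp prog "prog list"
  | Prec prog prog
  | Mu prog

fun eval :: "cantor \<Rightarrow> prog \<Rightarrow> nat list \<Rightarrow> nat option" where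
  "eval A Zero xs = Some 0"
| "eval A Succ xs = (case xs of [] \<Rightarrow> None | x # _ \<Rightarrow> Some (Suc x))"
| "eval A Query xs = (case xs of [] \<Rightarrow> None | x # _ \<Rightarrow> Some (if x \<in> A then 1 else 0))"
| "eval A (Proj i) xs = (if i < length xs then Some (xs ! i) else None)"
| "eval A (Comp f gs) xs = Option.bind (those (map (\<lambda>g. eval A g xs) gs)) (eval A f)"
| "eval A (Prec f g) xs = (case xs of [] \<Rightarrow> None | n # ys \<Rightarrow>
     rec_nat (eval A f ys) (\<lambda>m r. Option.bind r (\<lambda>v. eval A g (m # v # ys))) n)"
| "eval A (Mu f) xs =
     (if \<exists>m. eval A f (m # xs) = Some 0 \<and> (\<forall>k<m. eval A f (k # xs) \<noteq> None)
      then Some (LEAST m. eval A f (m # xs) = Some 0) else None)"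

text \<open>\<^term>\<open>computes p A B\<close>: the functional with index \<open>p\<close>, applied to \<open>A\<close>, is total and
  equals (the characteristic function of) \<open>B\<close>.\<close>

definition computes :: "prog \<Rightarrow> cantor \<Rightarrow> cantor \<Rightarrow> bool" where
  "computes p A B \<longleftrightarrow> (\<forall>n. eval A p [n] = Some (if n \<in> B then 1 else 0))"

text \<open>The join \<open>X \<oplus> Y\<close>, which also serves as the pairing of Cantor space.\<close>

definition join :: "cantor \<Rightarrow> cantor \<Rightarrow> cantor" where
  "join X Y = {2 * n | n. n \<in> X} \<union> {2 * n + 1 | n. n \<in> Y}"


section \<open>Problems and Weihrauch reducibility\<close>

text \<open>
  A partial multifunction on Cantor space is given by its graph \<open>P\<close>: the instances are the
  elements of \<^term>\<open>Domain P\<close>, and the solutions to \<open>X\<close> are the elements of \<^term>\<open>P `` {X}\<close>.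
  In particular every instance has a solution.
\<close>

type_synonym problem = "(cantor \<times> cantor) set"

definition weihrauch_le :: "problem \<Rightarrow> problem \<Rightarrow> bool" (infix "\<le>\<^sub>W" 50) where
  "Q \<le>\<^sub>W P \<longleftrightarrow> (\<exists>\<Phi> \<Psi>. \<forall>X\<in>Domain Q. \<exists>X'\<in>Domain P. computes \<Phi> X X' \<and>
     (\<forall>Y'\<in>P `` {X'}. \<exists>Y\<in>Q `` {X}. computes \<Psi> (join X Y') Y))"

definition weihrauch_eq :: "problem \<Rightarrow> problem \<Rightarrow> bool" (infix "\<equiv>\<^sub>W" 50) where
  "Q \<equiv>\<^sub>W P \<longleftrightarrow> Q \<le>\<^sub>W P \<and> P \<le>\<^sub>W Q"

definition product :: "problem \<Rightarrow> problem \<Rightarrow> problem" (infixr "\<times>\<^sub>W" 80) where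
  "P0 \<times>\<^sub>W P1 = {(join X0 X1, join Y0 Y1) | X0 X1 Y0 Y1. (X0, Y0) \<in> P0 \<and> (X1, Y1) \<in> P1}"

text \<open>In a pair \<open>\<langle>i, X\<rangle>\<close> the number \<open>i\<close> is coded by the singleton \<open>{i}\<close>.\<close>

definition coproduct :: "problem \<Rightarrow> problem \<Rightarrow> problem" (infixr "\<squnion>\<^sub>W" 65) where
  "P0 \<squnion>\<^sub>W P1 = {(join {0} X, Y) | X Y. (X, Y) \<in> P0} \<union> {(join {1} X, Y) | X Y. (X, Y) \<in> P1}"

definition composition :: "problem \<Rightarrow> problem \<Rightarrow> problem" (infixr "\<circ>\<^sub>W" 75) where
  "P1 \<circ>\<^sub>W P0 = {(X, Z). X \<in> Domain P0 \<and> P0 `` {X} \<subseteq> Domain P1 \<and>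
     (\<exists>Y. (X, Y) \<in> P0 \<and> (Y, Z) \<in> P1)}"

text \<open>
  The compositional product is a Weihrauch degree, that is, an equivalence class of problems. It is
  the class of those problems \<open>R\<close> whose degree is the maximum of the degrees of
  \<^term>\<open>Q1 \<circ>\<^sub>W Q0\<close> for \<^term>\<open>Q1 \<le>\<^sub>W P1\<close> and \<^term>\<open>Q0 \<le>\<^sub>W P0\<close>.
\<close>

definition compositional_product :: "problem \<Rightarrow> problem \<Rightarrow> problem set" (infixr "\<star>\<^sub>W" 75) where
  "P1 \<star>\<^sub>W P0 = {R.
     (\<exists>Q1 Q0. Q1 \<le>\<^sub>W P1 \<and> Q0 \<le>\<^sub>W P0 \<and> R \<equiv>\<^sub>W Q1 \<circ>\<^sub>W Q0) \<and>
     (\<forall>Q1 Q0. Q1 \<le>\<^sub>W P1 \<longrightarrow> Q0 \<le>\<^sub>W P0 \<longrightarrow> Q1 \<circ>\<^sub>W Q0 \<le>\<^sub>W R)}"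


section \<open>Ramsey's theorem for pairs and cohesiveness\<close>

text \<open>The two colors are \<^term>\<open>False\<close> and \<^term>\<open>True\<close>. A coloring of pairs is a binary function
  of which only the values \<open>c x y\<close> with \<open>x < y\<close> matter.\<close>

definition stable :: "(nat \<Rightarrow> nat \<Rightarrow> bool) \<Rightarrow> bool" where
  "stable c \<longleftrightarrow> (\<forall>x. \<exists>i. \<forall>\<^sub>F y in sequentially. c x y = i)"

definition homogeneous :: "(nat \<Rightarrow> nat \<Rightarrow> bool) \<Rightarrow> nat set \<Rightarrow> bool" where
  "homogeneous c H \<longleftrightarrow> (\<exists>i. \<forall>x\<in>H. \<forall>y\<in>H. x < y \<longrightarrow> c x y = i)"

text \<open>The binary function coded by an element of Cantor space. Every element of Cantor space codes
  a coloring of pairs, and likewise a sequence of colorings \<open>\<langle>c 0, c 1, \<dots>\<rangle>\<close> of the natural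
  numbers.\<close>

definition decode :: "cantor \<Rightarrow> nat \<Rightarrow> nat \<Rightarrow> bool" where
  "decode X = (\<lambda>x y. prod_encode (x, y) \<in> X)"

definition RT22 :: problem where
  "RT22 = {(X, H). infinite H \<and> homogeneous (decode X) H}"

definition SRT22 :: problem where
  "SRT22 = {(X, H). stable (decode X) \<and> (X, H) \<in> RT22}"

definition COH :: problem where
  "COH = {(X, C). infinite C \<and>
     (\<forall>i. \<exists>F. finite F \<and> (\<exists>j. \<forall>n\<in>C - F. decode X i n = j))}"

text \<open>As problems are given by their graphs, their instances are determined by Ramsey's theorem and
  the existence of cohesive sets: they are all colorings, all stable colorings, and all sequences of
  colorings, respectively.\<close>

lemma Domain_RT22: "Domain RT22 = UNIV"
proof -
  have "\<exists>H. infinite H \<and> homogeneous c H" for c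
  proof -
    define f :: "nat set \<Rightarrow> nat" where "f s = (if c (Min s) (Max s) then 1 else 0)" for s
    have "\<forall>x\<in>UNIV. \<forall>y\<in>UNIV. x \<noteq> y \<longrightarrow> f {x, y} < 2"
      by (simp add: f_def)
    from Ramsey2[OF infinite_UNIV_nat this] obtain H t where
      H: "infinite H" "\<forall>x\<in>H. \<forall>y\<in>H. x \<noteq> y \<longrightarrow> f {x, y} = t"
      by blast
    have "c x y = (t = 1)" if "x \<in> H" "y \<in> H" "x < y" for x y
    proof -
      have "f {x, y} = t" using H(2) that by auto
      moreover have "Min {x, y} = x" "Max {x, y} = y" using that by auto
      ultimately show ?thesis by (auto simp: f_def split: if_splits)
    qed
    then show ?thesis using H(1) unfolding homogeneous_def by blast
  qed
  then show ?thesis by (auto simp: RT22_def)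
qed

lemma Domain_SRT22: "Domain SRT22 = {X. stable (decode X)}"
  using Domain_RT22 by (auto simp: SRT22_def)

lemma Domain_COH: "Domain COH = UNIV"
proof -
  have "\<exists>C. (X, C) \<in> COH" for X
  proof -
    define P where "P n s \<longleftrightarrow> (\<exists>j. \<forall>m. decode X n (s m) = j)" for n and s :: "nat \<Rightarrow> nat"
    interpret subseqs P
    proof
      fix n and s :: "nat \<Rightarrow> nat"
      obtain j where inf: "infinite {m. decode X n (s m) = j}"
      proof -
        have "{m. decode X n (s m) = True} \<union> {m. decode X n (s m) = False} = (UNIV :: nat set)"
          by auto
        then have "infinite {m. decode X n (s m) = True} \<or> infinite {m. decode X n (s m) = False}"
          by (metis finite_Un infinite_UNIV_nat)
        then show ?thesis using that by blast
      qed
      let ?r = "enumerate {m. decode X n (s m) = j}"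
      have "strict_mono ?r" by (rule strict_mono_enumerate[OF inf])
      moreover have "P n (s \<circ> ?r)"
        using enumerate_in_set[OF inf] by (auto simp: P_def)
      ultimately show "\<exists>r. strict_mono r \<and> P n (s \<circ> r)" by blast
    qed
    have *: "P k (diagseq \<circ> (+) (Suc k))" for k
      by (rule diagseq_holds) (auto simp: P_def)
    have "\<exists>F. finite F \<and> (\<exists>j. \<forall>n\<in>range diagseq - F. decode X i n = j)" for i
    proof -
      obtain j where j: "decode X i (diagseq (Suc i + m)) = j" for m
        using *[of i] by (auto simp: P_def)
      have "decode X i (diagseq m) = j" if "m > i" for m
        using j[of "m - Suc i"] that by simp
      then have "\<forall>n\<in>range diagseq - diagseq ` {..i}. decode X i n = j"
        by (auto simp: not_le[symmetric])
      then show ?thesis by blast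
    qed
    moreover have "infinite (range diagseq)"
      by (rule range_inj_infinite[OF strict_mono_imp_inj_on[OF subseq_diagseq]])
    ultimately show ?thesis by (auto simp: COH_def)
  qed
  then show ?thesis by auto
qed

end

theory Submission
  imports Defs "HOL-Library.Countable"
begin

text \<open>
  The four positive reductions are explicit constructions. For the coproduct, a sequence of sets is
  turned into the coloring that compares its columns lexicographically, whose homogeneous sets are
  monotone in the lexicographic order and therefore cohesive. For the compositional product one
  exhibits \<open>Q1 \<le> SRT22\<close> and \<open>Q0 \<le> COH\<close> with \<open>Q1 \<circ> Q0\<close> equal to \<open>RT22\<close>, respectively to
  \<open>SRT22 \<times> COH\<close>: a set cohesive for the rows of a coloring makes the coloring stable.

  By transitivity only two nonreductions need a proof of their own. Both exploit that a solution
  algorithm commits itself: as soon as it has seen a finite part \<open>F\<close> of a homogeneous set, it names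
  two elements \<open>x < y\<close> of its answer, and if the instance is then continued so that all later
  pairs \<open>(x, z)\<close> receive the color opposite to that of \<open>(x, y)\<close>, then no infinite set containing
  \<open>x\<close> and \<open>y\<close> is homogeneous. Hence \<open>F\<close> must have lost all its infinite homogeneous extensions.

  \<open>RT22\<close> does not reduce to \<open>SRT22 \<times> COH\<close> (\<open>RT22_not_le_product\<close>). The algorithm assigns to each
  coloring a stable one. By the Baire category theorem the limit colors of the stable coloring are
  decided by finite conditions on the instance, so continuing the instance cannot change the limit
  colors of the elements of \<open>F\<close>. As cohesive sets survive finite changes, the only way for
  \<open>F\<close> to lose its extensions is that almost all elements have the other limit color. Doing
  this twice (\<open>killing_step\<close>) rules output both limit colors, which is absurd.

  \<open>SRT22 \<times> COH\<close> does not reduce to \<open>RT22\<close> (\<open>product_not_le_RT22\<close>). The algorithm now produces an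
  arbitrary coloring \<open>d\<close>, from an instance consisting of a stable coloring \<open>c\<close>, which is constant
  or changes its color once, and of a sequence \<open>R\<close>. If a finite homogeneous set \<open>F\<close> of
  color \<open>i\<close> has infinitely many one-point extensions but no infinite one, then \<open>d\<close> has an infinite
  homogeneous set of the other color that is obtained from \<open>d\<close> by a greedy procedure with finitely
  many parameters (\<open>ex_infinite_greedy\<close>), and so an \<open>R\<close>-cohesive set is obtained from
  \<open>R\<close> alone. Consider therefore the sets \<open>A\<close> such that no \<open>F \<subseteq> A\<close> of color 1 and
  no \<open>F \<subseteq> - A\<close> of color 0 makes the algorithm name a pair. If there is no such \<open>A\<close>, then by
  compactness finitely many \<open>F\<close> suffice to witness it; all pairs named by them can be made harmless
  at once, and the previous remark yields an \<open>R\<close>-cohesive set. If there is such an \<open>A\<close>, then one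
  color is missing from \<open>A\<close> or from its complement, and the greedy procedure obtains an
  \<open>R\<close>-cohesive set from \<open>R\<close> and \<open>A\<close>. Both are impossible for a suitable \<open>R\<close>, by the basis theorem
  \<open>non_cohesive_basis\<close>: there is an \<open>R\<close> for which every one of countably many compact classes
  depending on \<open>R\<close> has, if it is nonempty, a member \<open>A\<close> such that none of countably many
  continuous functionals maps \<open>R\<close> and \<open>A\<close> to an \<open>R\<close>-cohesive set.

  All functionals enter these two arguments only through the finite use principle \<open>eval_use\<close>.
\<close>

section \<open>Finite use and coding\<close>

definition agree :: "nat \<Rightarrow> cantor \<Rightarrow> cantor \<Rightarrow> bool" where
  "agree u A B \<longleftrightarrow> (\<forall>k<u. k \<in> A \<longleftrightarrow> k \<in> B)"

lemma snd_prod_decode_le: "snd (prod_decode n) \<le> n"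
  by (metis le_prod_encode_2 prod.collapse prod_decode_inverse)

lemma agree_refl [simp]: "agree u A A" by (simp add: agree_def)
lemma agree_sym: "agree u A B \<Longrightarrow> agree u B A" by (simp add: agree_def)
lemma agree_trans: "agree u A B \<Longrightarrow> agree u B C \<Longrightarrow> agree u A C" by (simp add: agree_def)
lemma agree_mono: "agree u A B \<Longrightarrow> w \<le> u \<Longrightarrow> agree w A B" by (simp add: agree_def)
lemma agreeD: "agree u A B \<Longrightarrow> k < u \<Longrightarrow> k \<in> A \<longleftrightarrow> k \<in> B" by (simp add: agree_def)

lemma join_even [simp]: "2 * n \<in> join X Y \<longleftrightarrow> n \<in> X"
  unfolding join_def by (auto; presburger)

lemma join_odd [simp]: "Suc (2 * n) \<in> join X Y \<longleftrightarrow> n \<in> Y"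
  unfolding join_def by (auto; presburger)

lemma mem_join: "k \<in> join X Y \<longleftrightarrow> (if even k then k div 2 \<in> X else k div 2 \<in> Y)"
  by (cases "even k") (auto elim!: evenE oddE)

lemma join_inject [simp]: "join X Y = join X' Y' \<longleftrightarrow> X = X' \<and> Y = Y'"
  by (metis join_even join_odd subsetI subset_antisym)

lemma agree_join: "agree u X X' \<Longrightarrow> agree u Y Y' \<Longrightarrow> agree u (join X Y) (join X' Y')"
  by (auto simp: agree_def mem_join)

text \<open>
  A convergent computation asks only finitely many questions, so it is already determined by a
  finite part of its oracle. For \<^const>\<open>Mu\<close> the computations that matter are those up to the value found.
\<close>

lemma eval_use:
  assumes "eval A p xs = Some v"
  shows "\<exists>u. \<forall>B. agree u A B \<longrightarrow> eval B p xs = Some v"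
  using assms
proof (induction p arbitrary: xs v)
  case Query
  then show ?case
    by (cases xs) (auto simp: agree_def intro!: exI[of _ "Suc (hd xs)"])
next
  case (Comp f gs)
  from Comp.prems obtain ys where ys: "those (map (\<lambda>g. eval A g xs) gs) = Some ys" "eval A f ys = Some v"
    by (auto simp: bind_eq_Some_conv)
  have "\<exists>u. \<forall>B. agree u A B \<longrightarrow> those (map (\<lambda>g. eval B g xs) gs) = Some ys"
    using ys(1) Comp.IH(2)
  proof (induction gs arbitrary: ys)
    case (Cons g gs)
    from Cons.prems(1) obtain w ws where w: "eval A g xs = Some w" "ys = w # ws"
      "those (map (\<lambda>g. eval A g xs) gs) = Some ws"
      by (auto split: option.splits)
    obtain u1 where "\<forall>B. agree u1 A B \<longrightarrow> eval B g xs = Some w"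
      using Cons.prems(2)[of g xs w] w(1) by auto
    moreover obtain u2 where "\<forall>B. agree u2 A B \<longrightarrow> those (map (\<lambda>g. eval B g xs) gs) = Some ws"
      using Cons.IH[OF w(3)] Cons.prems(2) by fastforce
    ultimately show ?case
      by (intro exI[of _ "max u1 u2"]) (auto simp: w(2) agree_mono)
  qed simp
  then obtain u1 where "\<forall>B. agree u1 A B \<longrightarrow> those (map (\<lambda>g. eval B g xs) gs) = Some ys" by blast
  moreover obtain u2 where "\<forall>B. agree u2 A B \<longrightarrow> eval B f ys = Some v"
    using Comp.IH(1)[OF ys(2)] by blast
  ultimately show ?case
    by (intro exI[of _ "max u1 u2"]) (auto simp: agree_mono)
next
  case (Prec f g)
  from Prec.prems obtain n ys where xs: "xs = n # ys" by (auto split: list.splits)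
  define r where "r B = rec_nat (eval B f ys) (\<lambda>m r. Option.bind r (\<lambda>v. eval B g (m # v # ys)))" for B
  have "r A n = Some v \<Longrightarrow> \<exists>u. \<forall>B. agree u A B \<longrightarrow> r B n = Some v"
  proof (induction n arbitrary: v)
    case 0 then show ?case using Prec.IH(1) by (simp add: r_def)
  next
    case (Suc n)
    then obtain w where w: "r A n = Some w" "eval A g (n # w # ys) = Some v"
      by (auto simp: r_def bind_eq_Some_conv)
    obtain u1 where u1: "\<forall>B. agree u1 A B \<longrightarrow> r B n = Some w" using Suc.IH[OF w(1)] by blast
    obtain u2 where u2: "\<forall>B. agree u2 A B \<longrightarrow> eval B g (n # w # ys) = Some v"
      using Prec.IH(2)[OF w(2)] by blast
    have "r B (Suc n) = Option.bind (r B n) (\<lambda>v. eval B g (n # v # ys))" for B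
      by (simp add: r_def)
    then show ?case using u1 u2
      by (intro exI[of _ "max u1 u2"]) (auto simp: agree_mono)
  qed
  with Prec.prems show ?case by (simp add: xs r_def)
next
  case (Mu f)
  define m where "m = (LEAST m. eval A f (m # xs) = Some 0)"
  from Mu.prems obtain m0 where m0: "eval A f (m0 # xs) = Some 0" "\<forall>k<m0. eval A f (k # xs) \<noteq> None"
    by (auto split: if_splits)
  have m: "eval A f (m # xs) = Some 0" unfolding m_def by (rule LeastI[of _ m0]) (rule m0)
  have least: "eval A f (k # xs) \<noteq> Some 0" if "k < m" for k
    using not_less_Least that unfolding m_def by blast
  have "m \<le> m0" unfolding m_def by (rule Least_le) (rule m0)
  with m0 have def: "\<forall>k<m. eval A f (k # xs) \<noteq> None" by auto
  have v: "v = m" using Mu.prems by (auto simp: m_def split: if_splits)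
  have "\<exists>u. \<forall>B. agree u A B \<longrightarrow> (\<forall>k<n. eval B f (k # xs) = eval A f (k # xs))" if "n \<le> Suc m" for n
    using that
  proof (induction n)
    case (Suc n)
    then obtain u1 where u1: "\<forall>B. agree u1 A B \<longrightarrow> (\<forall>k<n. eval B f (k # xs) = eval A f (k # xs))" by auto
    have "eval A f (n # xs) \<noteq> None" using Suc.prems def m by (cases "n = m") auto
    then obtain w where w: "eval A f (n # xs) = Some w" by auto
    obtain u2 where "\<forall>B. agree u2 A B \<longrightarrow> eval B f (n # xs) = Some w" using Mu.IH[OF w] by blast
    with u1 w have "eval B f (k # xs) = eval A f (k # xs)" if "agree (max u1 u2) A B" "k < Suc n" for B k
      using that agree_mono[OF that(1), of u1] agree_mono[OF that(1), of u2]
      by (cases "k = n") (simp, metis less_antisym max.cobounded1)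
    then show ?case by blast
  qed simp
  from this[OF order_refl] obtain u where u: "\<And>B k. agree u A B \<Longrightarrow> k < Suc m \<Longrightarrow> eval B f (k # xs) = eval A f (k # xs)"
    by blast
  have "eval B (Mu f) xs = Some v" if "agree u A B" for B
  proof -
    have e: "eval B f (k # xs) = eval A f (k # xs)" if "k \<le> m" for k 
      by (rule u[OF \<open>agree u A B\<close>]) (simp add: that less_Suc_eq_le)
    have "(LEAST m. eval B f (m # xs) = Some 0) = m"
    proof (rule Least_equality)
      show "eval B f (m # xs) = Some 0" using e m by simp
      show "m \<le> k" if "eval B f (k # xs) = Some 0" for k
        using that e[of k] least[of k] by (metis not_le less_imp_le)
    qed
    moreover have "\<exists>m. eval B f (m # xs) = Some 0 \<and> (\<forall>k<m. eval B f (k # xs) \<noteq> None)"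
      using e[OF order_refl] e[OF less_imp_le] m def by metis
    ultimately show ?thesis by (simp add: v)
  qed
  then show ?case by blast
qed (auto split: if_splits)

text \<open>
  Where \<open>p\<close> is total on \<open>A\<close> this is the set that it computes; the definition makes sense for all
  oracles, which spares a partiality discussion in continuity arguments.
\<close>

definition "output p A = {n. eval A p [n] = Some 1}"

lemma computes_output: "computes p A B \<Longrightarrow> B = output p A"
  by (auto simp: computes_def output_def)

definition encode :: "(nat \<Rightarrow> nat \<Rightarrow> bool) \<Rightarrow> cantor" where
  "encode c = {n. c (fst (prod_decode n)) (snd (prod_decode n))}"

lemma decode_encode [simp]: "decode (encode c) = c"
  by (simp add: encode_def decode_def)

definition left_part :: "cantor \<Rightarrow> cantor" where "left_part Z = {n. 2 * n \<in> Z}"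
definition right_part :: "cantor \<Rightarrow> cantor" where "right_part Z = {n. Suc (2 * n) \<in> Z}"

lemma left_part_join [simp]: "left_part (join X Y) = X" and right_part_join [simp]: "right_part (join X Y) = Y"
  by (simp_all add: left_part_def right_part_def)

lemma join_left_part_right_part: "join (left_part Z) (right_part Z) = Z"
  by (rule set_eqI) (auto simp: mem_join left_part_def right_part_def)

section \<open>Uniform computability\<close>

text \<open>
  Composition of functionals: each oracle question is answered by running the program \<open>q\<close>. The
  projection keeps the divergence of \<^const>\<open>Query\<close> on the empty argument list.
\<close>

primrec subst :: "prog \<Rightarrow> prog \<Rightarrow> prog" where
  "subst q Zero = Zero"
| "subst q Succ = Succ"
| "subst q Query = Comp q [Proj 0]"
| "subst q (Proj i) = Proj i"
| "subst q (Comp f gs) = Comp (subst q f) (map (subst q) gs)"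
| "subst q (Prec f g) = Prec (subst q f) (subst q g)"
| "subst q (Mu f) = Mu (subst q f)"

lemma eval_subst:
  assumes "computes q A B"
  shows "eval A (subst q p) = eval B p"
proof (induction p)
  case Query
  show ?case
    using assms by (auto simp: fun_eq_iff computes_def split: list.split)
next
  case (Comp f gs)
  then have "map (\<lambda>g. eval A g xs) (map (subst q) gs) = map (\<lambda>g. eval B g xs) gs" for xs
    by simp
  then show ?case by (intro ext) (simp add: Comp(1) del: map_map)
next
  case (Prec f g)
  show ?case by (rule ext) (unfold subst.simps eval.simps Prec, rule refl)
next
  case (Mu f)
  show ?case by (rule ext) (unfold subst.simps eval.simps Mu, rule refl)
qed (intro ext; simp)+

text \<open>
  Reducibility witnesses are single programs that work for all instances. Membership in the two
  predicates below therefore asks for one program for a whole family, indexed by \<open>i \<in> I\<close>, of oracles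
  \<open>a i\<close>; the index set also carries the side conditions under which the program has to be total.
  Closure properties then replace the writing of programs.
\<close>

definition unif_computes :: "'i set \<Rightarrow> ('i \<Rightarrow> cantor) \<Rightarrow> ('i \<Rightarrow> cantor) \<Rightarrow> bool" where
  "unif_computes I a b \<longleftrightarrow> (\<exists>p. \<forall>i\<in>I. computes p (a i) (b i))"

definition unif_fun :: "'i set \<Rightarrow> ('i \<Rightarrow> cantor) \<Rightarrow> nat \<Rightarrow> ('i \<Rightarrow> nat list \<Rightarrow> nat) \<Rightarrow> bool" where
  "unif_fun I a k f \<longleftrightarrow> (\<exists>p. \<forall>i\<in>I. \<forall>xs. length xs = k \<longrightarrow> eval (a i) p xs = Some (f i xs))"

abbreviation unif_pred :: "'i set \<Rightarrow> ('i \<Rightarrow> cantor) \<Rightarrow> nat \<Rightarrow> ('i \<Rightarrow> nat list \<Rightarrow> bool) \<Rightarrow> bool" where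
  "unif_pred I a k P \<equiv> unif_fun I a k (\<lambda>i xs. of_bool (P i xs))"

lemma unif_fun_cong:
  assumes "unif_fun I a k f" "\<And>i xs. i \<in> I \<Longrightarrow> length xs = k \<Longrightarrow> f i xs = g i xs"
  shows "unif_fun I a k g"
  using assms unfolding unif_fun_def by auto

lemma unif_computes_iff: "unif_computes I a b \<longleftrightarrow> unif_pred I a 1 (\<lambda>i xs. xs ! 0 \<in> b i)"
proof -
  have *: "(\<forall>xs::nat list. length xs = Suc 0 \<longrightarrow> Q xs) \<longleftrightarrow> (\<forall>n. Q [n])" for Q
    by (auto simp: length_Suc_conv)
  show ?thesis
    by (simp add: unif_computes_def unif_fun_def computes_def of_bool_def *)
qed

lemma unif_computes_trans: "unif_computes I a b \<Longrightarrow> unif_computes I b c \<Longrightarrow> unif_computes I a c"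
  unfolding unif_computes_def computes_def[of _ "_ :: cantor" "c _"] by (metis eval_subst computes_def)

lemma unif_computes_refl: "unif_computes I a a"
proof -
  have "computes Query A A" for A by (simp add: computes_def)
  then show ?thesis unfolding unif_computes_def by blast
qed

lemma unif_fun_comp1:
  assumes "unif_fun I a (Suc 0) (\<lambda>i ys. F i (ys ! 0))" "unif_fun I a k g"
  shows "unif_fun I a k (\<lambda>i xs. F i (g i xs))"
proof -
  obtain p where p: "\<And>i xs. i \<in> I \<Longrightarrow> length xs = Suc 0 \<Longrightarrow> eval (a i) p xs = Some (F i (xs ! 0))"
    using assms(1) unfolding unif_fun_def by blast
  obtain q where q: "\<And>i xs. i \<in> I \<Longrightarrow> length xs = k \<Longrightarrow> eval (a i) q xs = Some (g i xs)"
    using assms(2) unfolding unif_fun_def by blast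
  show ?thesis unfolding unif_fun_def by (rule exI[of _ "Comp p [q]"]) (simp add: p q)
qed

lemma unif_fun_comp2:
  assumes "unif_fun I a (Suc (Suc 0)) (\<lambda>i ys. F i (ys ! 0) (ys ! Suc 0))" "unif_fun I a k g" "unif_fun I a k h"
  shows "unif_fun I a k (\<lambda>i xs. F i (g i xs) (h i xs))"
proof -
  obtain p where p: "\<And>i xs. i \<in> I \<Longrightarrow> length xs = Suc (Suc 0) \<Longrightarrow> eval (a i) p xs = Some (F i (xs ! 0) (xs ! Suc 0))"
    using assms(1) unfolding unif_fun_def by blast
  obtain q where q: "\<And>i xs. i \<in> I \<Longrightarrow> length xs = k \<Longrightarrow> eval (a i) q xs = Some (g i xs)"
    using assms(2) unfolding unif_fun_def by blast
  obtain r where r: "\<And>i xs. i \<in> I \<Longrightarrow> length xs = k \<Longrightarrow> eval (a i) r xs = Some (h i xs)"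
    using assms(3) unfolding unif_fun_def by blast
  show ?thesis unfolding unif_fun_def by (rule exI[of _ "Comp p [q, r]"]) (simp add: p q r)
qed

lemma unif_fun_proj: "j < k \<Longrightarrow> unif_fun I a k (\<lambda>i xs. xs ! j)"
  unfolding unif_fun_def by (rule exI[of _ "Proj j"]) simp

lemma unif_fun_proj_tl: "Suc j < k \<Longrightarrow> unif_fun I a k (\<lambda>i xs. tl xs ! j)"
  by (rule unif_fun_cong[OF unif_fun_proj[of "Suc j"]]) (auto simp: nth_tl)

lemma unif_fun_proj_tl_tl: "Suc (Suc j) < k \<Longrightarrow> unif_fun I a k (\<lambda>i xs. tl (tl xs) ! j)"
  by (rule unif_fun_cong[OF unif_fun_proj[of "Suc (Suc j)"]]) (auto simp: nth_tl)

lemma unif_fun_Suc: "unif_fun I a k g \<Longrightarrow> unif_fun I a k (\<lambda>i xs. Suc (g i xs))"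
proof (rule unif_fun_comp1[where F = "\<lambda>i. Suc"])
  have "eval A Succ xs = Some (Suc (xs ! 0))" if "length xs = Suc 0" for A xs
    using that by (cases xs) auto
  then show "unif_fun I a (Suc 0) (\<lambda>i ys. Suc (ys ! 0))" unfolding unif_fun_def by blast
qed

lemma unif_fun_const: "unif_fun I a k (\<lambda>i xs. c)"
proof (induction c)
  case 0
  show ?case unfolding unif_fun_def by (rule exI[of _ Zero]) simp
next
  case (Suc c)
  then show ?case by (rule unif_fun_Suc)
qed

lemma unif_fun_prec:
  assumes "unif_fun I a k f" "unif_fun I a (Suc (Suc k)) g"
  shows "unif_fun I a (Suc k) (\<lambda>i xs. rec_nat (f i (tl xs)) (\<lambda>m r. g i (m # r # tl xs)) (xs ! 0))"
proof -
  obtain p where p: "\<And>i xs. i \<in> I \<Longrightarrow> length xs = k \<Longrightarrow> eval (a i) p xs = Some (f i xs)"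
    using assms(1) unfolding unif_fun_def by blast
  obtain q where q: "\<And>i xs. i \<in> I \<Longrightarrow> length xs = Suc (Suc k) \<Longrightarrow> eval (a i) q xs = Some (g i xs)"
    using assms(2) unfolding unif_fun_def by blast
  have "rec_nat (eval (a i) p ys) (\<lambda>m r. Option.bind r (\<lambda>v. eval (a i) q (m # v # ys))) n
      = Some (rec_nat (f i ys) (\<lambda>m r. g i (m # r # ys)) n)" if "i \<in> I" "length ys = k" for i n ys
    by (induction n) (simp_all add: p q that)
  then show ?thesis unfolding unif_fun_def
    by (intro exI[of _ "Prec p q"]) (auto simp: length_Suc_conv)
qed

lemma unif_fun_add: "unif_fun I a k g \<Longrightarrow> unif_fun I a k h \<Longrightarrow> unif_fun I a k (\<lambda>i xs. g i xs + h i xs)"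
proof (rule unif_fun_comp2[where F = "\<lambda>i. (+)"])
  have *: "rec_nat y (\<lambda>m r. Suc r) x = x + y" for x y :: nat by (induction x) auto
  have "unif_fun I a (Suc (Suc 0)) (\<lambda>i xs. rec_nat (tl xs ! 0) (\<lambda>m r. Suc ((m # r # tl xs) ! Suc 0)) (xs ! 0))"
    by (rule unif_fun_prec) (intro unif_fun_Suc unif_fun_proj; simp)+
  then show "unif_fun I a (Suc (Suc 0)) (\<lambda>i ys. ys ! 0 + ys ! Suc 0)"
    by (rule unif_fun_cong) (auto simp: * length_Suc_conv)
qed

lemma unif_fun_pred: "unif_fun I a k g \<Longrightarrow> unif_fun I a k (\<lambda>i xs. g i xs - 1)"
proof (rule unif_fun_comp1[where F = "\<lambda>i x. x - 1"])
  have *: "rec_nat 0 (\<lambda>m r. m) x = x - 1" for x :: nat by (cases x) auto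
  have "unif_fun I a (Suc 0) (\<lambda>i xs. rec_nat 0 (\<lambda>m r. (m # r # tl xs) ! 0) (xs ! 0))"
    by (rule unif_fun_prec) (intro unif_fun_const unif_fun_proj; simp)+
  then show "unif_fun I a (Suc 0) (\<lambda>i ys. ys ! 0 - 1)"
    by (rule unif_fun_cong) (auto simp: *)
qed

lemma unif_fun_diff: "unif_fun I a k g \<Longrightarrow> unif_fun I a k h \<Longrightarrow> unif_fun I a k (\<lambda>i xs. g i xs - h i xs)"
proof (rule unif_fun_comp2[where F = "\<lambda>i y x. x - y"])
  have *: "rec_nat y (\<lambda>m r. r - 1) x = y - x" for x y :: nat by (induction x) auto
  have "unif_fun I a (Suc (Suc 0)) (\<lambda>i xs. rec_nat (tl xs ! 0) (\<lambda>m r. ((m # r # tl xs) ! Suc 0) - 1) (xs ! 0))"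
    by (rule unif_fun_prec) (intro unif_fun_pred unif_fun_proj; simp)+
  then have "unif_fun I a (Suc (Suc 0)) (\<lambda>i xs. rec_nat (tl xs ! 0) (\<lambda>m r. r - 1) (xs ! 0))" by simp
  then show "unif_fun I a (Suc (Suc 0)) (\<lambda>i ys. ys ! Suc 0 - ys ! 0)"
    by (rule unif_fun_cong) (simp only: *, auto simp: length_Suc_conv)
qed

lemma unif_pred_le: "unif_fun I a k g \<Longrightarrow> unif_fun I a k h \<Longrightarrow> unif_pred I a k (\<lambda>i xs. g i xs \<le> h i xs)"
  by (rule unif_fun_cong[where f = "\<lambda>i xs. 1 - (g i xs - h i xs)"]) (auto intro: unif_fun_diff unif_fun_const)

lemma unif_pred_not: "unif_pred I a k P \<Longrightarrow> unif_pred I a k (\<lambda>i xs. \<not> P i xs)"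
  by (rule unif_fun_cong[where f = "\<lambda>i xs. 1 - of_bool (P i xs)"]) (auto intro: unif_fun_diff unif_fun_const)

lemma unif_pred_or: "unif_pred I a k P \<Longrightarrow> unif_pred I a k Q \<Longrightarrow> unif_pred I a k (\<lambda>i xs. P i xs \<or> Q i xs)"
  by (rule unif_fun_cong[where f = "\<lambda>i xs. 1 - (1 - (of_bool (P i xs) + of_bool (Q i xs)))"])
    (auto intro!: unif_fun_diff unif_fun_add unif_fun_const)

lemma unif_pred_and: "unif_pred I a k P \<Longrightarrow> unif_pred I a k Q \<Longrightarrow> unif_pred I a k (\<lambda>i xs. P i xs \<and> Q i xs)"
  using unif_pred_not[OF unif_pred_or[OF unif_pred_not unif_pred_not], of I a k P Q] by simp

lemma unif_pred_iff: "unif_pred I a k P \<Longrightarrow> unif_pred I a k Q \<Longrightarrow> unif_pred I a k (\<lambda>i xs. P i xs = Q i xs)"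
  by (rule unif_fun_cong[where f = "\<lambda>i xs. of_bool ((P i xs \<and> Q i xs) \<or> (\<not> P i xs \<and> \<not> Q i xs))"])
    (rule unif_pred_or unif_pred_and unif_pred_not | assumption | simp)+

lemma unif_pred_eq: "unif_fun I a k g \<Longrightarrow> unif_fun I a k h \<Longrightarrow> unif_pred I a k (\<lambda>i xs. g i xs = h i xs)"
  using unif_pred_and[OF unif_pred_le unif_pred_le, of I a k g h h g] by (simp add: order_eq_iff)

lemma unif_pred_less: "unif_fun I a k g \<Longrightarrow> unif_fun I a k h \<Longrightarrow> unif_pred I a k (\<lambda>i xs. g i xs < h i xs)"
  using unif_pred_le[OF unif_fun_Suc, of I a k g h] by (simp add: Suc_le_eq)

text \<open>
  Unbounded search; its success is needed only on the index set. The predicate takes the search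
  variable separately from the remaining arguments so that nested searches can be written with
  ordinary binders.
\<close>

lemma unif_fun_least:
  assumes "unif_pred I a (Suc k) (\<lambda>i ys. P i (ys ! 0) (tl ys))"
    and "\<And>i xs. i \<in> I \<Longrightarrow> length xs = k \<Longrightarrow> \<exists>m. P i m xs"
  shows "unif_fun I a k (\<lambda>i xs. LEAST m. P i m xs)"
proof -
  obtain p where p: "\<And>i xs. i \<in> I \<Longrightarrow> length xs = Suc k \<Longrightarrow> eval (a i) p xs = Some (of_bool (\<not> P i (xs ! 0) (tl xs)))"
    using unif_pred_not[OF assms(1)] unfolding unif_fun_def by blast
  have "eval (a i) (Mu p) xs = Some (LEAST m. P i m xs)" if "i \<in> I" "length xs = k" for i xs
    using assms(2)[OF that] that by (simp add: p)
  then show ?thesis unfolding unif_fun_def by blast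
qed

text \<open>
  The least \<open>m\<close> that satisfies \<open>P\<close> or exceeds the bound always exists, and it does not exceed the bound
  if and only if there is a witness below it.
\<close>

lemma unif_pred_bex:
  assumes "unif_pred I a (Suc k) (\<lambda>i ys. P i (ys ! 0) (tl ys))" and b: "unif_fun I a k b"
  shows "unif_pred I a k (\<lambda>i xs. \<exists>m\<le>b i xs. P i m xs)"
proof -
  have tl: "unif_fun I a (Suc k) (\<lambda>i xs. b i (tl xs))"
  proof -
    obtain p where p: "\<And>i xs. i \<in> I \<Longrightarrow> length xs = k \<Longrightarrow> eval (a i) p xs = Some (b i xs)"
      using b unfolding unif_fun_def by blast
    have *: "those (map (\<lambda>g. eval A g xs) (map (\<lambda>j. Proj (Suc j)) [0..<k])) = Some (tl xs)"
      if "length xs = Suc k" for A xs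
    proof -
      have "map (\<lambda>g. eval A g xs) (map (\<lambda>j. Proj (Suc j)) [0..<k]) = map Some (tl xs)"
        using that by (intro nth_equalityI) (auto simp: nth_tl)
      moreover have "those (map Some ys) = Some ys" for ys :: "nat list" by (induction ys) auto
      ultimately show ?thesis by simp
    qed
    show ?thesis unfolding unif_fun_def
      by (rule exI[of _ "Comp p (map (\<lambda>j. Proj (Suc j)) [0..<k])"]) (simp add: p * del: map_map)
  qed
  have "unif_pred I a k (\<lambda>i xs. (LEAST m. P i m xs \<or> b i xs < m) \<le> b i xs)"
    by (intro unif_pred_le unif_fun_least unif_pred_or unif_pred_less assms tl unif_fun_proj) auto
  moreover have "(LEAST m. P i m xs \<or> b i xs < m) \<le> b i xs \<longleftrightarrow> (\<exists>m\<le>b i xs. P i m xs)" (is "?l \<le> _ \<longleftrightarrow> _") for i xs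
  proof
    assume "?l \<le> b i xs"
    moreover have "P i ?l xs \<or> b i xs < ?l" by (rule LeastI[of _ "Suc (b i xs)"]) simp
    ultimately show "\<exists>m\<le>b i xs. P i m xs" by auto
  next
    assume "\<exists>m\<le>b i xs. P i m xs"
    then show "?l \<le> b i xs" using Least_le[of "\<lambda>m. P i m xs \<or> b i xs < m"] by (meson order_trans)
  qed
  ultimately show ?thesis by simp
qed

lemma unif_pred_mem: "unif_computes I a b \<Longrightarrow> unif_fun I a k g \<Longrightarrow> unif_pred I a k (\<lambda>i xs. g i xs \<in> b i)"
  by (rule unif_fun_comp1[where F = "\<lambda>i n. of_bool (n \<in> b i)"]) (simp_all add: unif_computes_iff)

lemma unif_fun_half: "unif_fun I a k g \<Longrightarrow> unif_fun I a k (\<lambda>i xs. g i xs div 2)"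
proof (rule unif_fun_comp1[where F = "\<lambda>i n. n div 2"])
  have "(LEAST m. n \<le> m + m + 1) = n div 2" for n :: nat
    by (rule Least_equality) auto
  moreover have "unif_fun I a (Suc 0) (\<lambda>i xs. LEAST m. xs ! 0 \<le> m + m + 1)"
  proof (rule unif_fun_least)
    show "\<exists>m. xs ! 0 \<le> m + m + 1" for xs :: "nat list" by (rule exI[of _ "xs ! 0"]) simp
  qed (intro unif_pred_le unif_fun_add unif_fun_const unif_fun_proj unif_fun_proj_tl; simp)
  ultimately show "unif_fun I a (Suc 0) (\<lambda>i ys. ys ! 0 div 2)" by simp
qed

lemma unif_pred_even: "unif_fun I a k g \<Longrightarrow> unif_pred I a k (\<lambda>i xs. even (g i xs))"
proof -
  assume g: "unif_fun I a k g"
  have "even n \<longleftrightarrow> n div 2 + n div 2 = n" for n :: nat by presburger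
  then show ?thesis using unif_pred_eq[OF unif_fun_add[OF unif_fun_half unif_fun_half], OF g g g] by simp
qed

lemma unif_computes_join: "unif_computes I a b \<Longrightarrow> unif_computes I a c \<Longrightarrow> unif_computes I a (\<lambda>i. join (b i) (c i))"
  unfolding unif_computes_iff[where b = "\<lambda>i. join (b i) (c i)"] mem_join if_bool_eq_disj
  by (intro unif_pred_or unif_pred_and unif_pred_not unif_pred_mem unif_pred_even unif_fun_half unif_fun_proj) simp_all

lemma unif_computes_fst: "unif_computes I a (\<lambda>i. join (b i) (c i)) \<Longrightarrow> unif_computes I a b"
proof -
  assume *: "unif_computes I a (\<lambda>i. join (b i) (c i))"
  have "unif_pred I a 1 (\<lambda>i xs. xs ! 0 + xs ! 0 \<in> join (b i) (c i))"
    by (intro unif_pred_mem * unif_fun_add unif_fun_proj; simp)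
  then show ?thesis by (simp add: unif_computes_iff flip: mult_2)
qed

lemma unif_computes_snd: "unif_computes I a (\<lambda>i. join (b i) (c i)) \<Longrightarrow> unif_computes I a c"
proof -
  assume *: "unif_computes I a (\<lambda>i. join (b i) (c i))"
  have "unif_pred I a 1 (\<lambda>i xs. Suc (xs ! 0 + xs ! 0) \<in> join (b i) (c i))"
    by (intro unif_pred_mem * unif_fun_Suc unif_fun_add unif_fun_proj; simp)
  then show ?thesis by (simp add: unif_computes_iff flip: mult_2)
qed

lemma unif_computes_empty: "unif_computes I a (\<lambda>i. {})"
  unfolding unif_computes_iff using unif_fun_const[of I a 1 0] by simp

lemma unif_computes_if0: "unif_computes I a d \<Longrightarrow> unif_computes I a b \<Longrightarrow> unif_computes I a c \<Longrightarrow> unif_computes I a (\<lambda>i. if 0 \<in> d i then b i else c i)"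
  unfolding unif_computes_iff[where b = "\<lambda>i. if 0 \<in> d i then b i else c i"] if_distrib[where f = "(\<in>) x" for x] if_bool_eq_disj
  by (intro unif_pred_or unif_pred_and unif_pred_not unif_pred_mem unif_fun_const unif_fun_proj) simp_all

lemma unif_fun_prod_encode:
  "unif_fun I a k g \<Longrightarrow> unif_fun I a k h \<Longrightarrow> unif_fun I a k (\<lambda>i xs. prod_encode (g i xs, h i xs))"
proof -
  assume g: "unif_fun I a k g" and h: "unif_fun I a k h"
  have t: "rec_nat 0 (\<lambda>m r. Suc (r + m)) n = triangle n" for n by (induction n) auto
  have "unif_fun I a (Suc 0) (\<lambda>i xs. rec_nat 0 (\<lambda>m r. ((m # r # tl xs) ! Suc 0) + Suc ((m # r # tl xs) ! 0)) (xs ! 0))"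
    by (rule unif_fun_prec) (intro unif_fun_const unif_fun_add unif_fun_Suc unif_fun_proj; simp)+
  then have "unif_fun I a (Suc 0) (\<lambda>i xs. triangle (xs ! 0))" by (simp add: t)
  from unif_fun_comp1[where F = "\<lambda>i. triangle", OF this unif_fun_add[OF g h]] g
  show ?thesis by (simp add: prod_encode_def unif_fun_add)
qed

lemma unif_pred_decode: "unif_computes I a b \<Longrightarrow> unif_fun I a k g \<Longrightarrow> unif_fun I a k h
    \<Longrightarrow> unif_pred I a k (\<lambda>i xs. decode (b i) (g i xs) (h i xs))"
  unfolding decode_def by (intro unif_pred_mem unif_fun_prod_encode)

lemma prod_encode_eq_iff: "prod_encode (x, y) = n \<longleftrightarrow> x = fst (prod_decode n) \<and> y = snd (prod_decode n)"
  by (metis prod.collapse prod_decode_inverse prod_encode_inverse prod.inject)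

lemma unif_fun_prod_decode:
  "unif_fun I a (Suc 0) (\<lambda>i xs. fst (prod_decode (xs ! 0)))" "unif_fun I a (Suc 0) (\<lambda>i xs. snd (prod_decode (xs ! 0)))"
proof -
  note le = snd_prod_decode_le
  have "(LEAST x. \<exists>y\<le>n. prod_encode (x, y) = n) = fst (prod_decode n)" for n
    by (rule Least_equality) (auto simp: prod_encode_eq_iff le)
  moreover have "unif_fun I a (Suc 0) (\<lambda>i xs. LEAST x. \<exists>y\<le>xs ! 0. prod_encode (x, y) = xs ! 0)"
  proof (rule unif_fun_least)
    show "\<exists>m. \<exists>y\<le>xs ! 0. prod_encode (m, y) = xs ! 0" for xs :: "nat list"
      by (auto simp: prod_encode_eq_iff le)
  qed (intro unif_pred_bex unif_pred_eq unif_fun_prod_encode unif_fun_proj unif_fun_proj_tl unif_fun_proj_tl_tl; simp)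
  ultimately show 1: "unif_fun I a (Suc 0) (\<lambda>i xs. fst (prod_decode (xs ! 0)))" by simp
  have "(LEAST y. \<exists>x\<le>n. prod_encode (x, y) = n) = snd (prod_decode n)" for n
    by (rule Least_equality)
      (auto simp: prod_encode_eq_iff, metis le_prod_encode_1 prod.collapse prod_decode_inverse)
  moreover have "unif_fun I a (Suc 0) (\<lambda>i xs. LEAST y. \<exists>x\<le>xs ! 0. prod_encode (x, y) = xs ! 0)"
  proof (rule unif_fun_least)
    show "\<exists>m. \<exists>y\<le>xs ! 0. prod_encode (y, m) = xs ! 0" for xs :: "nat list"
      by (auto simp: prod_encode_eq_iff) (metis le_prod_encode_1 prod.collapse prod_decode_inverse)
  qed (intro unif_pred_bex unif_pred_eq unif_fun_prod_encode unif_fun_proj unif_fun_proj_tl unif_fun_proj_tl_tl; simp)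
  ultimately show "unif_fun I a (Suc 0) (\<lambda>i xs. snd (prod_decode (xs ! 0)))" by simp
qed

lemma unif_computes_encode:
  assumes "unif_pred I a (Suc (Suc 0)) (\<lambda>i xs. c i (xs ! 0) (xs ! Suc 0))"
  shows "unif_computes I a (\<lambda>i. encode (c i))"
  unfolding unif_computes_iff encode_def mem_Collect_eq One_nat_def
  by (rule unif_fun_comp2[where F = "\<lambda>i x y. of_bool (c i x y)", OF assms unif_fun_prod_decode])

section \<open>Weihrauch reducibility and the positive reductions\<close>

lemma unif_computes_left_part: "unif_computes I a b \<Longrightarrow> unif_computes I a (\<lambda>i. left_part (b i))"
  and unif_computes_right_part: "unif_computes I a b \<Longrightarrow> unif_computes I a (\<lambda>i. right_part (b i))"
  by (rule unif_computes_fst[where c = "\<lambda>i. right_part (b i)"], simp add: join_left_part_right_part)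
    (rule unif_computes_snd[where b = "\<lambda>i. left_part (b i)"], simp add: join_left_part_right_part)

lemma unif_computes_reindex: "unif_computes J a b \<Longrightarrow> h ` I \<subseteq> J \<Longrightarrow> unif_computes I (\<lambda>i. a (h i)) (\<lambda>i. b (h i))"
  unfolding unif_computes_def by blast

text \<open>
  Weihrauch reducibility in terms of functions rather than programs; the converse follows.
\<close>

lemma weihrauch_leI:
  assumes "unif_computes (Domain Q) (\<lambda>X. X) \<phi>"
    and "\<And>X. X \<in> Domain Q \<Longrightarrow> \<phi> X \<in> Domain P"
    and "unif_computes {(X, Y). X \<in> Domain Q \<and> (\<phi> X, Y) \<in> P} (\<lambda>p. join (fst p) (snd p)) (\<lambda>p. \<psi> (fst p) (snd p))"
    and "\<And>X Y. X \<in> Domain Q \<Longrightarrow> (\<phi> X, Y) \<in> P \<Longrightarrow> (X, \<psi> X Y) \<in> Q"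
  shows "Q \<le>\<^sub>W P"
proof -
  obtain p where p: "\<And>X. X \<in> Domain Q \<Longrightarrow> computes p X (\<phi> X)"
    using assms(1) unfolding unif_computes_def by blast
  obtain q where q: "\<And>X Y. X \<in> Domain Q \<Longrightarrow> (\<phi> X, Y) \<in> P \<Longrightarrow> computes q (join X Y) (\<psi> X Y)"
    using assms(3) unfolding unif_computes_def by auto
  show ?thesis unfolding weihrauch_le_def
  proof (intro exI ballI)
    fix X assume X: "X \<in> Domain Q"
    then show "\<exists>X'\<in>Domain P. computes p X X' \<and> (\<forall>Y'\<in>P `` {X'}. \<exists>Y\<in>Q `` {X}. computes q (join X Y') Y)"
    proof (intro bexI conjI ballI)
      fix Y assume "Y \<in> P `` {\<phi> X}"
      then have Y: "(\<phi> X, Y) \<in> P" by simp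
      show "computes q (join X Y) (\<psi> X Y)" by (rule q[OF X Y])
      show "\<psi> X Y \<in> Q `` {X}" using assms(4)[OF X Y] by simp
    qed (use p assms(2) in simp_all)
  qed
qed

lemma weihrauch_leE:
  assumes "Q \<le>\<^sub>W P"
  obtains \<phi> \<psi> where "unif_computes (Domain Q) (\<lambda>X. X) \<phi>"
    and "\<And>X. X \<in> Domain Q \<Longrightarrow> \<phi> X \<in> Domain P"
    and "unif_computes {(X, Y). X \<in> Domain Q \<and> (\<phi> X, Y) \<in> P} (\<lambda>p. join (fst p) (snd p)) (\<lambda>p. \<psi> (fst p) (snd p))"
    and "\<And>X Y. X \<in> Domain Q \<Longrightarrow> (\<phi> X, Y) \<in> P \<Longrightarrow> (X, \<psi> X Y) \<in> Q"
proof -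
  obtain p q where pq: "\<And>X. X \<in> Domain Q \<Longrightarrow> \<exists>X'\<in>Domain P. computes p X X' \<and>
     (\<forall>Y'\<in>P `` {X'}. \<exists>Y\<in>Q `` {X}. computes q (join X Y') Y)"
    using assms unfolding weihrauch_le_def by blast
  define \<phi> \<psi> where "\<phi> X = output p X" and "\<psi> X Y = output q (join X Y)" for X Y
  have 1: "computes p X (\<phi> X)" "\<phi> X \<in> Domain P" if "X \<in> Domain Q" for X
    using pq[OF that] computes_output unfolding \<phi>_def by metis+
  have 2: "computes q (join X Y) (\<psi> X Y)" "(X, \<psi> X Y) \<in> Q" if "X \<in> Domain Q" "(\<phi> X, Y) \<in> P" for X Y
    using pq[OF that(1)] that(2) computes_output unfolding \<phi>_def \<psi>_def by (metis Image_singleton_iff)+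
  show thesis
  proof (rule that)
    show "unif_computes (Domain Q) (\<lambda>X. X) \<phi>" using 1 unfolding unif_computes_def by blast
    show "unif_computes {(X, Y). X \<in> Domain Q \<and> (\<phi> X, Y) \<in> P} (\<lambda>p. join (fst p) (snd p)) (\<lambda>p. \<psi> (fst p) (snd p))"
      using 2 unfolding unif_computes_def by auto
  qed (use 1 2 in auto)
qed

lemma weihrauch_trans:
  assumes "Q \<le>\<^sub>W P" "P \<le>\<^sub>W R"
  shows "Q \<le>\<^sub>W R"
proof -
  from assms(1) obtain \<phi>1 \<psi>1 where 1: "unif_computes (Domain Q) (\<lambda>X. X) \<phi>1"
    "\<And>X. X \<in> Domain Q \<Longrightarrow> \<phi>1 X \<in> Domain P"
    "unif_computes {(X, Y). X \<in> Domain Q \<and> (\<phi>1 X, Y) \<in> P} (\<lambda>p. join (fst p) (snd p)) (\<lambda>p. \<psi>1 (fst p) (snd p))"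
    "\<And>X Y. X \<in> Domain Q \<Longrightarrow> (\<phi>1 X, Y) \<in> P \<Longrightarrow> (X, \<psi>1 X Y) \<in> Q"
    by (rule weihrauch_leE) blast
  from assms(2) obtain \<phi>2 \<psi>2 where 2: "unif_computes (Domain P) (\<lambda>X. X) \<phi>2"
    "\<And>X. X \<in> Domain P \<Longrightarrow> \<phi>2 X \<in> Domain R"
    "unif_computes {(X, Y). X \<in> Domain P \<and> (\<phi>2 X, Y) \<in> R} (\<lambda>p. join (fst p) (snd p)) (\<lambda>p. \<psi>2 (fst p) (snd p))"
    "\<And>X Y. X \<in> Domain P \<Longrightarrow> (\<phi>2 X, Y) \<in> R \<Longrightarrow> (X, \<psi>2 X Y) \<in> P"
    by (rule weihrauch_leE) blast
  let ?I = "{(X, Y). X \<in> Domain Q \<and> (\<phi>2 (\<phi>1 X), Y) \<in> R}"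
  let ?a = "\<lambda>p. join (fst p) (snd p) :: cantor"
  show ?thesis
  proof (rule weihrauch_leI)
    show "unif_computes (Domain Q) (\<lambda>X. X) (\<lambda>X. \<phi>2 (\<phi>1 X))"
      using 1(1) by (rule unif_computes_trans) (rule unif_computes_reindex[OF 2(1)], use 1(2) in auto)
    have X: "unif_computes ?I ?a fst" and Y: "unif_computes ?I ?a snd"
      using unif_computes_refl unif_computes_fst unif_computes_snd by fast+
    have "unif_computes ?I ?a (\<lambda>p. \<phi>1 (fst p))"
      using X by (rule unif_computes_trans) (rule unif_computes_reindex[OF 1(1)], auto)
    from unif_computes_join[OF this Y] have Y': "unif_computes ?I ?a (\<lambda>p. \<psi>2 (\<phi>1 (fst p)) (snd p))"
      by (rule unif_computes_trans)
        (use unif_computes_reindex[OF 2(3), of "\<lambda>p. (\<phi>1 (fst p), snd p)" ?I] 1(2) in force)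
    from unif_computes_join[OF X this] show "unif_computes ?I ?a (\<lambda>p. \<psi>1 (fst p) (\<psi>2 (\<phi>1 (fst p)) (snd p)))"
      by (rule unif_computes_trans)
        (use unif_computes_reindex[OF 1(3), of "\<lambda>p. (fst p, \<psi>2 (\<phi>1 (fst p)) (snd p))" ?I] 1(2) 2(4) in force)
  qed (use 1 2 in auto)
qed

text \<open>
  The columns \<open>(decode R i x)\<^sub>i\<close> and \<open>(decode R i y)\<^sub>i\<close>, cut off after position \<open>x\<close>, are compared in the
  lexicographic order; the color says whether the first is strictly smaller. The negated bounded
  quantifier is the form to which the closure properties of computable predicates apply.
\<close>

definition lex_coloring :: "cantor \<Rightarrow> nat \<Rightarrow> nat \<Rightarrow> bool" where
  "lex_coloring R x y \<longleftrightarrow> (\<exists>i\<le>x. (\<not> decode R i x \<and> decode R i y) \<and>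
     \<not> (\<exists>j\<le>i. j < i \<and> \<not> decode R j x = decode R j y))"

lemma monotone_eventually_constant:
  fixes f :: "nat \<Rightarrow> bool"
  assumes "finite F" "\<And>x y. x \<in> H - F \<Longrightarrow> y \<in> H - F \<Longrightarrow> x < y \<Longrightarrow> f x \<longrightarrow> f y"
  shows "\<exists>F'. finite F' \<and> (\<exists>j. \<forall>n\<in>H - F'. f n = j)"
proof (cases "\<exists>x\<in>H - F. f x")
  case True
  then obtain x where x: "x \<in> H - F" "f x" by blast
  have "f y = True" if "y \<in> H - (F \<union> {..x})" for y
    using assms(2)[of x y] x that by auto
  moreover have "finite (F \<union> {..x})" using assms(1) by simp
  ultimately show ?thesis by blast
next
  case False
  then show ?thesis using assms(1) by (intro exI[of _ F] conjI exI[of _ False]) auto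
qed

text \<open>
  Along a homogeneous set the columns are monotone in the lexicographic order. By induction on \<open>i\<close>, once
  the entries before position \<open>i\<close> have stabilized, the entries at position \<open>i\<close> are themselves monotone
  and so stabilize as well.
\<close>

lemma homogeneous_lex_coloring_cohesive:
  assumes "infinite H" "homogeneous (lex_coloring R) H"
  shows "(R, H) \<in> COH"
proof -
  obtain v where "\<forall>x\<in>H. \<forall>y\<in>H. x < y \<longrightarrow> lex_coloring R x y = v"
    using assms(2) unfolding homogeneous_def ..
  then have v: "\<And>x y. x \<in> H \<Longrightarrow> y \<in> H \<Longrightarrow> x < y \<Longrightarrow> lex_coloring R x y = v" by blast
  have "\<exists>F. finite F \<and> (\<exists>j. \<forall>n\<in>H - F. decode R i n = j)" for i
  proof (induction i rule: less_induct)
    case (less i)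
    then have "\<forall>k. \<exists>F. k < i \<longrightarrow> finite F \<and> (\<exists>j. \<forall>n\<in>H - F. decode R k n = j)"
      by (metis (full_types))
    from choice[OF this] obtain F where
      F: "\<And>k. k < i \<Longrightarrow> finite (F k)" "\<And>k. k < i \<Longrightarrow> \<exists>j. \<forall>n\<in>H - F k. decode R k n = j"
      by blast
    define G where "G = {..i} \<union> (\<Union>k<i. F k)"
    have fin: "finite G" using F(1) by (auto simp: G_def)
    have eq: "decode R k x = decode R k y" if "x \<in> H - G" "y \<in> H - G" "k < i" for x y k
    proof -
      have "x \<in> H - F k" "y \<in> H - F k" using that by (auto simp: G_def)
      then show ?thesis using F(2)[OF that(3)] by metis
    qed
    have gt: "i \<le> x" if "x \<in> H - G" for x using that by (auto simp: G_def)
    show ?case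
    proof (cases v)
      case True
      have "decode R i x \<longrightarrow> decode R i y" if x: "x \<in> H - G" "y \<in> H - G" "x < y" for x y
      proof -
        obtain k where k: "\<not> decode R k x" "decode R k y" "\<And>j. j < k \<Longrightarrow> decode R j x = decode R j y"
          using v[of x y] x True unfolding lex_coloring_def by auto
        then have "i \<le> k" using eq[OF x(1,2)] by (metis not_le)
        then show ?thesis using k by (cases "i = k") auto
      qed
      from monotone_eventually_constant[OF fin this] show ?thesis .
    next
      case False
      have "\<not> decode R i x \<longrightarrow> \<not> decode R i y" if x: "x \<in> H - G" "y \<in> H - G" "x < y" for x y
        using v[of x y] x False gt[OF x(1)] eq[OF x(1,2)] unfolding lex_coloring_def by auto
      have "\<exists>F'. finite F' \<and> (\<exists>j. \<forall>n\<in>H - F'. (\<not> decode R i n) = j)"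
        by (rule monotone_eventually_constant[OF fin]) fact
      then obtain F' j where "finite F'" "\<forall>n\<in>H - F'. (\<not> decode R i n) = j" by (elim exE conjE)
      then show ?thesis by (intro exI[of _ F'] conjI exI[of _ "\<not> j"]) auto
    qed
  qed
  then show ?thesis using assms(1) by (simp add: COH_def)
qed

lemma unif_computes_lex_coloring: "unif_computes I a r \<Longrightarrow> unif_computes I a (\<lambda>i. encode (lex_coloring (r i)))"
  unfolding lex_coloring_def
  by (intro unif_computes_encode unif_pred_bex unif_pred_and unif_pred_not unif_pred_decode unif_pred_iff unif_pred_less
      unif_fun_proj unif_fun_proj_tl unif_fun_proj_tl_tl) simp_all

lemma coproduct_le_RT22: "SRT22 \<squnion>\<^sub>W COH \<le>\<^sub>W RT22"
proof (rule weihrauch_leI)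
  let ?\<phi> = "\<lambda>Z. if 0 \<in> left_part Z then right_part Z else encode (lex_coloring (right_part Z))"
  show "unif_computes (Domain (SRT22 \<squnion>\<^sub>W COH)) (\<lambda>X. X) ?\<phi>"
    by (intro unif_computes_if0 unif_computes_lex_coloring unif_computes_left_part unif_computes_right_part unif_computes_refl)
  show "unif_computes {(X, Y). X \<in> Domain (SRT22 \<squnion>\<^sub>W COH) \<and> (?\<phi> X, Y) \<in> RT22} (\<lambda>p. join (fst p) (snd p)) (\<lambda>p. snd p)"
    using unif_computes_refl unif_computes_snd by fast
  show "(X, H) \<in> SRT22 \<squnion>\<^sub>W COH" if "X \<in> Domain (SRT22 \<squnion>\<^sub>W COH)" "(?\<phi> X, H) \<in> RT22" for X H
    using that homogeneous_lex_coloring_cohesive[of H "right_part X"]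
    by (auto simp: coproduct_def SRT22_def RT22_def)
qed (simp add: Domain_RT22)

lemma SRT22_stable: "(c, H) \<in> SRT22 \<Longrightarrow> stable (decode c)"
  by (simp add: SRT22_def)

lemma stable_empty: "stable (decode {})"
  by (auto simp: stable_def decode_def)

lemma coproduct_le_product: "SRT22 \<squnion>\<^sub>W COH \<le>\<^sub>W SRT22 \<times>\<^sub>W COH"
proof (rule weihrauch_leI)
  let ?\<phi> = "\<lambda>Z. if 0 \<in> left_part Z then join (right_part Z) {} else join {} (right_part Z)"
  show "unif_computes (Domain (SRT22 \<squnion>\<^sub>W COH)) (\<lambda>X. X) ?\<phi>"
    by (intro unif_computes_if0 unif_computes_join unif_computes_empty unif_computes_left_part unif_computes_right_part unif_computes_refl)
  let ?\<psi> = "\<lambda>Z Y. if 0 \<in> left_part Z then left_part Y else right_part Y"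
  show "?\<phi> X \<in> Domain (SRT22 \<times>\<^sub>W COH)" if X: "X \<in> Domain (SRT22 \<squnion>\<^sub>W COH)" for X
  proof -
    have *: "join U V \<in> Domain (SRT22 \<times>\<^sub>W COH)" if U: "stable (decode U)" for U V
    proof -
      obtain A B where "(U, A) \<in> SRT22" "(V, B) \<in> COH"
        using U Domain_SRT22 Domain_COH by blast
      then show ?thesis unfolding product_def by blast
    qed
    from X show ?thesis
      by (auto simp: coproduct_def stable_empty dest: SRT22_stable intro!: *)
  qed
  show "(X, ?\<psi> X Y) \<in> SRT22 \<squnion>\<^sub>W COH" if "X \<in> Domain (SRT22 \<squnion>\<^sub>W COH)" "(?\<phi> X, Y) \<in> SRT22 \<times>\<^sub>W COH" for X Y
    using that by (auto simp: coproduct_def product_def)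
  show "unif_computes {(X, Y). X \<in> Domain (SRT22 \<squnion>\<^sub>W COH) \<and> (?\<phi> X, Y) \<in> SRT22 \<times>\<^sub>W COH}
      (\<lambda>p. join (fst p) (snd p)) (\<lambda>p. ?\<psi> (fst p) (snd p))" (is "unif_computes ?I ?a _")
  proof -
    have "unif_computes ?I ?a fst" "unif_computes ?I ?a snd" using unif_computes_refl unif_computes_fst unif_computes_snd by fast+
    then show ?thesis by (intro unif_computes_if0 unif_computes_left_part unif_computes_right_part)
  qed
qed

text \<open>
  If all solutions of the first problem are instances of the second, then the domain condition in
  the composition is void.
\<close>

lemma composition_eq_relcomp:
  assumes "\<And>X Y. (X, Y) \<in> P0 \<Longrightarrow> Y \<in> Domain P1"
  shows "P1 \<circ>\<^sub>W P0 = P0 O P1"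
  unfolding composition_def relcomp_unfold using assms by auto

text \<open>
  The stable coloring has to survive the first step, so \<open>Q0\<close> passes it on next to the cohesive set,
  and \<open>Q1\<close> in turn passes on the cohesive set.
\<close>

lemma product_le_compositional:
  assumes "S \<in> SRT22 \<star>\<^sub>W COH"
  shows "SRT22 \<times>\<^sub>W COH \<le>\<^sub>W S"
proof -
  define Q0 where "Q0 = {(join c R, join c C) | c R C. stable (decode c) \<and> (R, C) \<in> COH}"
  define Q1 where "Q1 = {(join c C, join H C) | c C H. (c, H) \<in> SRT22}"
  have "Q0 \<le>\<^sub>W COH"
  proof (rule weihrauch_leI)
    show "unif_computes (Domain Q0) (\<lambda>X. X) right_part" by (intro unif_computes_right_part unif_computes_refl)
    let ?\<psi> = "\<lambda>X C. join (left_part X) C"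
    show "unif_computes {(X, Y). X \<in> Domain Q0 \<and> (right_part X, Y) \<in> COH} (\<lambda>p. join (fst p) (snd p)) (\<lambda>p. ?\<psi> (fst p) (snd p))" (is "unif_computes ?I ?a _")
    proof -
      have "unif_computes ?I ?a fst" "unif_computes ?I ?a snd" using unif_computes_refl unif_computes_fst unif_computes_snd by fast+
      then show ?thesis by (intro unif_computes_join unif_computes_left_part)
    qed
  qed (auto simp: Q0_def Domain_COH)
  moreover have "Q1 \<le>\<^sub>W SRT22"
  proof (rule weihrauch_leI)
    show "unif_computes (Domain Q1) (\<lambda>X. X) left_part" by (intro unif_computes_left_part unif_computes_refl)
    let ?\<psi> = "\<lambda>X H. join H (right_part X)"
    show "unif_computes {(X, Y). X \<in> Domain Q1 \<and> (left_part X, Y) \<in> SRT22} (\<lambda>p. join (fst p) (snd p)) (\<lambda>p. ?\<psi> (fst p) (snd p))" (is "unif_computes ?I ?a _")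
    proof -
      have "unif_computes ?I ?a fst" "unif_computes ?I ?a snd" using unif_computes_refl unif_computes_fst unif_computes_snd by fast+
      then show ?thesis by (intro unif_computes_join unif_computes_right_part)
    qed
  qed (auto simp: Q1_def)
  ultimately have "Q1 \<circ>\<^sub>W Q0 \<le>\<^sub>W S" using assms unfolding compositional_product_def by blast
  moreover have "Q1 \<circ>\<^sub>W Q0 = Q0 O Q1"
  proof (rule composition_eq_relcomp)
    fix X Y assume "(X, Y) \<in> Q0"
    then obtain c C where "Y = join c C" "c \<in> Domain SRT22" by (auto simp: Q0_def Domain_SRT22)
    then show "Y \<in> Domain Q1" unfolding Q1_def by blast
  qed
  moreover have "Q0 O Q1 = SRT22 \<times>\<^sub>W COH"
    unfolding relcomp_unfold Q0_def Q1_def product_def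
    by auto (use SRT22_stable in blast)
  ultimately show ?thesis by simp
qed

definition next_in :: "nat set \<Rightarrow> nat \<Rightarrow> nat" where
  "next_in C x = (LEAST m. x \<le> m \<and> m \<in> C)"

lemma next_in: "infinite C \<Longrightarrow> x \<le> next_in C x" "infinite C \<Longrightarrow> next_in C x \<in> C"
proof -
  assume "infinite C"
  then have "\<exists>m. x \<le> m \<and> m \<in> C" by (auto simp: infinite_nat_iff_unbounded_le)
  from LeastI_ex[OF this] show "x \<le> next_in C x" "next_in C x \<in> C" by (auto simp: next_in_def)
qed

lemma next_in_mono: "infinite C \<Longrightarrow> x \<le> y \<Longrightarrow> next_in C x \<le> next_in C y"
  unfolding next_in_def[of C x] using next_in[of C y] by (intro Least_le) auto

text \<open>
  Inverting \<^const>\<open>next_in\<close> requires no unbounded search, in contrast to evaluating it.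
\<close>

lemma next_in_eq_iff:
  "infinite C \<Longrightarrow> next_in C x = n \<longleftrightarrow> x \<le> n \<and> n \<in> C \<and> \<not> (\<exists>m\<le>n. m < n \<and> x \<le> m \<and> m \<in> C)"
proof
  assume C: "infinite C" and "next_in C x = n"
  then show "x \<le> n \<and> n \<in> C \<and> \<not> (\<exists>m\<le>n. m < n \<and> x \<le> m \<and> m \<in> C)"
    using next_in[OF C, of x] not_less_Least[of _ "\<lambda>m. x \<le> m \<and> m \<in> C"] by (auto simp: next_in_def)
next
  assume "x \<le> n \<and> n \<in> C \<and> \<not> (\<exists>m\<le>n. m < n \<and> x \<le> m \<and> m \<in> C)"
  then show "next_in C x = n" unfolding next_in_def
    by (intro Least_equality) (simp, meson le_less_trans less_imp_le not_le)
qed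

text \<open>
  A set \<open>C\<close> that is cohesive for the rows of a coloring makes its restriction to \<open>C\<close> stable. The
  restriction is transported to a coloring of all pairs by replacing each number by the next element of
  \<open>C\<close>; numbers with the same next element do no harm, as only pairs with distinct images matter in the
  end.
\<close>

lemma RT22_le_compositional:
  assumes "S \<in> SRT22 \<star>\<^sub>W COH"
  shows "RT22 \<le>\<^sub>W S"
proof -
  define Q0 where "Q0 = {(c, join c C) | c C. (c, C) \<in> COH}"
  define Q1 where "Q1 = {(join c C, H) | c C H. (c, C) \<in> COH \<and> (c, H) \<in> RT22}"
  have "Q0 \<le>\<^sub>W COH"
  proof (rule weihrauch_leI)
    show "unif_computes (Domain Q0) (\<lambda>X. X) (\<lambda>X. X)" by (rule unif_computes_refl)
    show "unif_computes {(X, Y). X \<in> Domain Q0 \<and> (X, Y) \<in> COH} (\<lambda>p. join (fst p) (snd p)) (\<lambda>p. join (fst p) (snd p))"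
      by (rule unif_computes_refl)
  qed (auto simp: Q0_def)
  moreover have "Q1 \<le>\<^sub>W SRT22"
  proof (rule weihrauch_leI)
    let ?c = "\<lambda>X x y. decode (left_part X) (next_in (right_part X) x) (next_in (right_part X) y)"
    let ?\<psi> = "\<lambda>X H. {n. \<exists>x\<le>n. x \<in> H \<and> (n \<in> right_part X \<and> \<not> (\<exists>m\<le>n. m < n \<and> x \<le> m \<and> m \<in> right_part X))}"
    have inf: "infinite (right_part X)" if "X \<in> Domain Q1" for X
      using that by (auto simp: Q1_def COH_def)
    have nxt: "unif_fun (Domain Q1) (\<lambda>X. X) k (\<lambda>X xs. next_in (right_part X) (xs ! j))" if "j < k" for j k
      unfolding next_in_def
    proof (rule unif_fun_least)
      show "\<exists>m. xs ! j \<le> m \<and> m \<in> right_part X" if "X \<in> Domain Q1" for X and xs :: "nat list"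
        using inf[OF that] by (auto simp: infinite_nat_iff_unbounded_le)
    qed (intro unif_pred_and unif_pred_le unif_pred_mem unif_computes_right_part unif_computes_refl unif_fun_proj unif_fun_proj_tl; use that in simp)
    show "unif_computes (Domain Q1) (\<lambda>X. X) (\<lambda>X. encode (?c X))"
      by (intro unif_computes_encode unif_pred_decode unif_computes_left_part unif_computes_refl nxt) simp_all
    show "unif_computes {(X, Y). X \<in> Domain Q1 \<and> (encode (?c X), Y) \<in> SRT22} (\<lambda>p. join (fst p) (snd p))
        (\<lambda>p. ?\<psi> (fst p) (snd p))" (is "unif_computes ?I ?a _")
    proof -
      have X: "unif_computes ?I ?a fst" and Y: "unif_computes ?I ?a snd" using unif_computes_refl unif_computes_fst unif_computes_snd by fast+
      have "unif_pred ?I ?a 1 (\<lambda>p xs. \<exists>x\<le>xs ! 0. x \<in> snd p \<and> (xs ! 0 \<in> right_part (fst p) \<and>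
          \<not> (\<exists>m\<le>xs ! 0. m < xs ! 0 \<and> x \<le> m \<and> m \<in> right_part (fst p))))"
        by (intro unif_pred_bex unif_pred_and unif_pred_not unif_pred_less unif_pred_le unif_pred_mem unif_computes_right_part X Y
            unif_fun_proj unif_fun_proj_tl unif_fun_proj_tl_tl) simp_all
      then show ?thesis by (simp only: unif_computes_iff mem_Collect_eq)
    qed
    fix X assume "X \<in> Domain Q1"
    then obtain c C where X: "X = join c C" and C: "(c, C) \<in> COH" by (auto simp: Q1_def)
    have infC: "infinite C" using C by (simp add: COH_def)
    have "stable (\<lambda>x y. decode c (next_in C x) (next_in C y))"
      unfolding stable_def
    proof
      fix x
      have "\<forall>i. \<exists>F. finite F \<and> (\<exists>j. \<forall>n\<in>C - F. decode c i n = j)"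
        using C by (simp add: COH_def)
      then obtain F j where F: "finite F" "\<forall>n\<in>C - F. decode c (next_in C x) n = j"
        by (elim allE[of _ "next_in C x"] exE conjE)
      from F(1) obtain N where N: "\<And>n. n \<in> F \<Longrightarrow> n < N" by (meson finite_nat_set_iff_bounded)
      have "decode c (next_in C x) (next_in C y) = j" if "y \<ge> N" for y
      proof -
        have "y \<le> next_in C y" "next_in C y \<in> C" using next_in[OF infC] by auto
        moreover from this N[of "next_in C y"] that have "next_in C y \<notin> F" by linarith
        ultimately show ?thesis using F(2) by simp
      qed
      then show "\<exists>i. \<forall>\<^sub>F y in sequentially. decode c (next_in C x) (next_in C y) = i"
        unfolding eventually_sequentially by blast
    qed
    then show "encode (?c X) \<in> Domain SRT22" by (simp add: Domain_SRT22 X)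
    fix H assume "(encode (?c X), H) \<in> SRT22"
    then obtain i where H: "infinite H" "\<And>x y. x \<in> H \<Longrightarrow> y \<in> H \<Longrightarrow> x < y \<Longrightarrow> decode c (next_in C x) (next_in C y) = i"
      by (simp add: SRT22_def RT22_def homogeneous_def X) metis
    have *: "n \<in> ?\<psi> X H \<longleftrightarrow> (\<exists>x\<in>H. next_in C x = n)" for n
      unfolding next_in_eq_iff[OF infC] by (auto simp: X)
    have eq: "?\<psi> X H = next_in C ` H" by (rule set_eqI) (unfold *, auto)
    have "infinite (next_in C ` H)"
      using H(1) next_in(1)[OF infC] unfolding infinite_nat_iff_unbounded_le by (meson imageI order_trans)
    moreover have "homogeneous (decode c) (next_in C ` H)"
      unfolding homogeneous_def
    proof (intro exI ballI impI)
      fix u v assume "u \<in> next_in C ` H" "v \<in> next_in C ` H" "u < v"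
      then obtain x y where xy: "x \<in> H" "y \<in> H" "u = next_in C x" "v = next_in C y" by auto
      then have "x < y" using next_in_mono[OF infC, of y x] \<open>u < v\<close> by linarith
      then show "decode c u v = i" using H(2) xy by simp
    qed
    ultimately show "(X, ?\<psi> X H) \<in> Q1"
      unfolding eq using C by (auto simp: Q1_def X RT22_def)
  qed
  ultimately have "Q1 \<circ>\<^sub>W Q0 \<le>\<^sub>W S" using assms unfolding compositional_product_def by blast
  moreover have "Q1 \<circ>\<^sub>W Q0 = Q0 O Q1"
  proof (rule composition_eq_relcomp)
    fix X Y assume "(X, Y) \<in> Q0"
    moreover have "X \<in> Domain RT22" by (simp add: Domain_RT22)
    ultimately show "Y \<in> Domain Q1" unfolding Q0_def Q1_def by blast
  qed
  moreover have "Q0 O Q1 = RT22"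
  proof -
    have "(X, H) \<in> Q0 O Q1 \<longleftrightarrow> (X, H) \<in> RT22" for X H
    proof
      assume H: "(X, H) \<in> RT22"
      obtain C where C: "(X, C) \<in> COH" using Domain_COH by blast
      have "(X, join X C) \<in> Q0" using C unfolding Q0_def by blast
      moreover have "(join X C, H) \<in> Q1" using C H unfolding Q1_def by blast
      ultimately show "(X, H) \<in> Q0 O Q1" by (rule relcompI)
    qed (auto simp: Q0_def Q1_def)
    then show ?thesis by auto
  qed
  ultimately show ?thesis by simp
qed

section \<open>Greedy homogeneous sets\<close>


definition monochromatic :: "(nat \<Rightarrow> nat \<Rightarrow> bool) \<Rightarrow> bool \<Rightarrow> nat set \<Rightarrow> bool" where
  "monochromatic d i H \<longleftrightarrow> (\<forall>x\<in>H. \<forall>y\<in>H. x < y \<longrightarrow> d x y = i)"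

lemma homogeneous_iff: "homogeneous d H \<longleftrightarrow> (\<exists>i. monochromatic d i H)"
  by (simp add: homogeneous_def monochromatic_def)

lemma monochromatic_subset: "monochromatic d i H \<Longrightarrow> F \<subseteq> H \<Longrightarrow> monochromatic d i F"
  by (auto simp: monochromatic_def)

fun greedy_fun :: "(nat \<Rightarrow> nat \<Rightarrow> bool) \<Rightarrow> bool \<Rightarrow> nat set \<Rightarrow> nat \<Rightarrow> bool" where
  "greedy_fun d i S x \<longleftrightarrow> x \<in> S \<and> (\<forall>y\<in>{..<x}. greedy_fun d i S y \<longrightarrow> d y x = i)"

declare greedy_fun.simps [simp del]

text \<open>
  The set obtained from \<open>S\<close> by running through its elements in increasing order and keeping those
  that continue the homogeneous set built so far. Being decided below each \<open>u\<close> by the parts of \<open>S\<close> and \<open>d\<close> below \<open>u\<close>,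
  it depends continuously on them even when it is finite.
\<close>

definition greedy :: "(nat \<Rightarrow> nat \<Rightarrow> bool) \<Rightarrow> bool \<Rightarrow> nat set \<Rightarrow> nat set" where
  "greedy d i S = {x. greedy_fun d i S x}"

lemma greedy_iff: "x \<in> greedy d i S \<longleftrightarrow> x \<in> S \<and> (\<forall>y<x. y \<in> greedy d i S \<longrightarrow> d y x = i)"
  by (auto simp: greedy_def greedy_fun.simps[of d i S x])

lemma greedy_subset: "greedy d i S \<subseteq> S"
  by (metis greedy_iff subsetI)

lemma monochromatic_greedy: "monochromatic d i (greedy d i S)"
  unfolding monochromatic_def by (metis greedy_iff)

lemma greedy_cong:
  assumes "\<And>x. x < u \<Longrightarrow> x \<in> S \<longleftrightarrow> x \<in> S'" "\<And>x y. x < y \<Longrightarrow> y < u \<Longrightarrow> d x y = d' x y"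
  shows "agree u (greedy d i S) (greedy d' i S')"
  unfolding agree_def
proof (intro allI impI)
  fix k assume "k < u"
  then show "k \<in> greedy d i S \<longleftrightarrow> k \<in> greedy d' i S'"
  proof (induction k rule: less_induct)
    case (less k)
    then show ?case using assms by (subst (1 2) greedy_iff) (meson less_trans)
  qed
qed

lemma agree_greedy:
  assumes "monochromatic d i (S \<inter> {..<u})"
  shows "agree u S (greedy d i S)"
  unfolding agree_def
proof (intro allI impI)
  fix k assume "k < u"
  then show "k \<in> S \<longleftrightarrow> k \<in> greedy d i S"
  proof (induction k rule: less_induct)
    case (less k)
    then have "y \<in> greedy d i S \<longleftrightarrow> y \<in> S" if "y < k" for y using that by auto
    then show ?case using less.prems assms by (subst greedy_iff) (auto simp: monochromatic_def)
  qed
qed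

text \<open>
  If the procedure kept only finitely many elements, then almost all elements of \<open>S\<close> would be admissible
  with respect to all of them.
\<close>

lemma infinite_greedy:
  assumes "infinite S" "\<And>x. x \<in> S \<Longrightarrow> finite {z \<in> S. x < z \<and> d x z \<noteq> i}"
  shows "infinite (greedy d i S)"
proof
  assume fin: "finite (greedy d i S)"
  let ?E = "(\<Union>x\<in>greedy d i S. {..x} \<union> {z \<in> S. x < z \<and> d x z \<noteq> i})"
  have "finite ?E" using fin assms(2) greedy_subset[of d i S] by auto
  then have "infinite (S - ?E)" using assms(1) by (rule Diff_infinite_finite)
  then obtain z where "z \<in> S - ?E" using infinite_imp_nonempty by blast
  then have z: "z \<in> S" "z \<notin> ?E" by simp_all
  have "d y z = i" if "y < z" "y \<in> greedy d i S" for y using z that by auto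
  with z(1) have "z \<in> greedy d i S" by (subst greedy_iff) simp
  with z(2) show False by auto
qed


definition cantor_closed :: "cantor set \<Rightarrow> bool" where
  "cantor_closed K \<longleftrightarrow> (\<forall>X. (\<forall>u. \<exists>Y\<in>K. agree u X Y) \<longrightarrow> X \<in> K)"

text \<open>
  The Baire category theorem in a closed subspace of Cantor space, with the neighborhood that has to
  be met fixed in advance. The limit of a sequence of successively refined finite conditions is the
  desired point.
\<close>

lemma baire:
  assumes K: "cantor_closed K" "X0 \<in> K"
    and dense: "\<And>k Y u. Y \<in> K \<Longrightarrow> agree n X0 Y \<Longrightarrow> n \<le> u \<Longrightarrow>
      \<exists>Z\<in>K. agree u Y Z \<and> (\<exists>w. \<forall>W\<in>K. agree w Z W \<longrightarrow> P k W)"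
  shows "\<exists>X\<in>K. agree n X0 X \<and> (\<forall>k::nat. \<exists>w. \<forall>W\<in>K. agree w X W \<longrightarrow> P k W)"
proof -
  define good where "good s \<longleftrightarrow> fst s \<in> K \<and> agree n X0 (fst s) \<and> n \<le> snd s" for s :: "cantor \<times> nat"
  define step where "step k s t \<longleftrightarrow> agree (snd s) (fst s) (fst t) \<and> snd s < snd t
      \<and> (\<forall>W\<in>K. agree (snd t) (fst t) W \<longrightarrow> P k W)" for k and s t :: "cantor \<times> nat"
  have "\<exists>f. \<forall>k. good (f k) \<and> step k (f k) (f (Suc k))"
  proof (rule dependent_nat_choice)
    show "\<exists>s. good s" using K(2) by (auto simp: good_def intro!: exI[of _ "(X0, n)"])
    fix s k assume s: "good s"
    from dense[of "fst s" "snd s" k] s obtain Z w where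
      Z: "Z \<in> K" "agree (snd s) (fst s) Z" "\<forall>W\<in>K. agree w Z W \<longrightarrow> P k W"
      by (auto simp: good_def)
    have "step k s (Z, max w (Suc (snd s)))"
      unfolding step_def fst_conv snd_conv
    proof (intro conjI ballI impI)
      fix W assume "W \<in> K" "agree (max w (Suc (snd s))) Z W"
      then show "P k W" using Z(3) agree_mono[of _ Z W w] by simp
    qed (use Z(2) in simp_all)
    moreover have "good (Z, max w (Suc (snd s)))"
      using s Z agree_trans[of n X0 "fst s" Z] agree_mono[OF Z(2), of n] by (auto simp: good_def)
    ultimately show "\<exists>t. good t \<and> step k s t" by blast
  qed
  then obtain f where f: "\<And>k. good (f k)" "\<And>k. step k (f k) (f (Suc k))" by auto
  define Y u where "Y k = fst (f k)" and "u k = snd (f k)" for k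
  have mono: "strict_mono u"
    using f(2) by (simp add: strict_mono_Suc_iff u_def step_def)
  then have ge: "k \<le> u k" for k by (rule strict_mono_imp_increasing)
  have step: "agree (u k) (Y k) (Y (Suc k))" for k using f(2)[of k] by (simp add: step_def Y_def u_def)
  have coh: "agree (u k) (Y k) (Y j)" if "k \<le> j" for k j
    using that
  proof (induction j rule: dec_induct)
    case (step j)
    have "u k \<le> u j" using step(1) mono by (simp add: strict_mono_less_eq)
    then show ?case using step \<open>agree (u j) (Y j) (Y (Suc j))\<close> by (meson agree_mono agree_trans)
  qed simp
  \<comment> \<open>Condition \<open>u (Suc m)\<close> exceeds \<open>m\<close>, so membership of \<open>m\<close> is final from stage \<open>Suc m\<close> on.\<close>
  define X where "X = {m. m \<in> Y (Suc m)}"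
  have X: "agree (u k) (Y k) X" for k
    unfolding agree_def
  proof (intro allI impI)
    fix m assume m: "m < u k"
    show "m \<in> Y k \<longleftrightarrow> m \<in> X"
    proof (cases "k \<le> Suc m")
      case True then show ?thesis using coh[OF True] m by (auto simp: X_def agree_def)
    next
      case False
      then have "agree (u (Suc m)) (Y (Suc m)) (Y k)" by (intro coh) simp
      moreover have "m < u (Suc m)" using ge[of "Suc m"] by simp
      ultimately show ?thesis by (auto simp: X_def agree_def)
    qed
  qed
  have "X \<in> K"
  proof -
    have "\<exists>Z\<in>K. agree v X Z" for v
    proof
      show "Y v \<in> K" using f(1)[of v] by (simp add: good_def Y_def)
      show "agree v X (Y v)" using X[of v] ge[of v] by (meson agree_mono agree_sym)
    qed
    then show ?thesis using K(1) unfolding cantor_closed_def by blast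
  qed
  moreover have "agree n X0 X"
    using f(1)[of 0] X[of 0] unfolding good_def Y_def u_def by (meson agree_mono agree_trans)
  moreover have "\<exists>w. \<forall>W\<in>K. agree w X W \<longrightarrow> P k W" for k
  proof (intro exI ballI impI)
    fix W assume W: "W \<in> K" "agree (u (Suc k)) X W"
    then have "agree (u (Suc k)) (Y (Suc k)) W" using X agree_trans by blast
    then show "P k W" using W(1) f(2)[of k] by (simp add: step_def Y_def u_def)
  qed
  ultimately show ?thesis by blast
qed

definition has_limit :: "(nat \<Rightarrow> nat \<Rightarrow> bool) \<Rightarrow> nat \<Rightarrow> bool \<Rightarrow> bool" where
  "has_limit d x i \<longleftrightarrow> (\<forall>\<^sub>F y in sequentially. d x y = i)"

text \<open>
  A continuous assignment of stable colorings is locally constant, in the sense of limit colors, at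
  some point. For otherwise no finite condition would decide some limit color, and the conditions
  could be refined alternately towards both values, giving in the limit a coloring that is not stable
  at \<open>x\<close>.
\<close>

lemma generic_limits:
  assumes K: "cantor_closed K" "K \<noteq> {}"
    and cont: "\<And>X x z. X \<in> K \<Longrightarrow> \<exists>w. \<forall>Y\<in>K. agree w X Y \<longrightarrow> D Y x z = D X x z"
    and st: "\<And>X. X \<in> K \<Longrightarrow> stable (D X)"
  shows "\<exists>X\<in>K. \<forall>x. \<exists>w v. \<forall>Y\<in>K. agree w X Y \<longrightarrow> has_limit (D Y) x v"
proof -
  have dense: "\<exists>Z\<in>K. agree u Y Z \<and> (\<exists>w v. \<forall>W\<in>K. agree w Z W \<longrightarrow> has_limit (D W) x v)" if Y: "Y \<in> K" for x Y u
  proof (rule ccontr)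
    assume no: "\<not> ?thesis"
    \<comment> \<open>Near every point the value \<open>even k\<close> can be forced at some \<open>z \<ge> k\<close>, as \<open>odd k\<close> is not forced
      to be the limit.\<close>
    have "\<exists>X\<in>K. agree u Y X \<and> (\<forall>k::nat. \<exists>w. \<forall>W\<in>K. agree w X W \<longrightarrow> (\<exists>z\<ge>k. D W x z = even k))"
    proof (rule baire[OF K(1) Y])
      fix k :: nat and Z t assume Z: "Z \<in> K" "agree u Y Z" "u \<le> t"
      with no have "\<not> (\<forall>W\<in>K. agree t Z W \<longrightarrow> has_limit (D W) x (odd k))" by blast
      then obtain W where W: "W \<in> K" "agree t Z W" "\<not> has_limit (D W) x (odd k)" by blast
      then obtain z where z: "z \<ge> k" "D W x z = even k"
        unfolding has_limit_def eventually_sequentially by (metis (full_types))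
      obtain w where "\<forall>V\<in>K. agree w W V \<longrightarrow> D V x z = D W x z" using cont[OF W(1)] by blast
      with W z show "\<exists>W\<in>K. agree t Z W \<and> (\<exists>w. \<forall>V\<in>K. agree w W V \<longrightarrow> (\<exists>z\<ge>k. D V x z = even k))"
        by metis
    qed
    then obtain X where X: "X \<in> K" "\<And>k. \<exists>z\<ge>k. D X x z = even k" by (meson agree_refl)
    obtain i N where N: "\<And>y. y \<ge> N \<Longrightarrow> D X x y = i"
      using st[OF X(1)] unfolding stable_def eventually_sequentially by blast
    obtain z1 where "z1 \<ge> 2 * N" "D X x z1 = even (2 * N)" using X(2) by blast
    moreover obtain z2 where "z2 \<ge> Suc (2 * N)" "D X x z2 = even (Suc (2 * N))" using X(2) by blast
    ultimately show False using N[of z1] N[of z2] by simp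
  qed
  obtain X0 where "X0 \<in> K" using K(2) by blast
  have "\<exists>X\<in>K. agree 0 X0 X \<and> (\<forall>x. \<exists>w. \<forall>W\<in>K. agree w X W \<longrightarrow>
      (\<exists>v. \<exists>t. \<forall>V\<in>K. agree t W V \<longrightarrow> has_limit (D V) x v))"
  proof (rule baire[OF K(1) \<open>X0 \<in> K\<close>])
    fix x Y u assume "Y \<in> K"
    from dense[OF this, of u x] obtain Z w v where
      Z: "Z \<in> K" "agree u Y Z" "\<forall>W\<in>K. agree w Z W \<longrightarrow> has_limit (D W) x v" by blast
    then show "\<exists>Z\<in>K. agree u Y Z \<and> (\<exists>w. \<forall>W\<in>K. agree w Z W \<longrightarrow>
        (\<exists>v t. \<forall>V\<in>K. agree t W V \<longrightarrow> has_limit (D V) x v))"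
      by (meson agree_trans)
  qed
  then show ?thesis by (meson agree_refl)
qed

section \<open>Ramsey's theorem does not reduce to the product\<close>

lemma has_limit_iff: "has_limit d x i \<longleftrightarrow> finite {z. d x z \<noteq> i}"
  by (simp add: has_limit_def eventually_cofinite flip: cofinite_eq_sequentially)

lemma stable_limit: "stable d \<Longrightarrow> \<exists>i. has_limit d x i"
  by (simp add: stable_def has_limit_def)

lemma ex_monochromatic: "\<exists>H i. infinite H \<and> monochromatic d i H"
proof -
  obtain H where "(encode d, H) \<in> RT22" using Domain_RT22 by blast
  then show ?thesis by (auto simp: RT22_def homogeneous_iff)
qed

lemma ex_cohesive: "\<exists>C. (X, C) \<in> COH"
  using Domain_COH by blast

lemma COH_finite_change:
  assumes "(R, C) \<in> COH" "finite A"
  shows "(R, A \<union> (C - {..<u})) \<in> COH"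
proof -
  have "\<exists>F. finite F \<and> (\<exists>j. \<forall>n\<in>A \<union> (C - {..<u}) - F. decode R i n = j)" for i
  proof -
    have "\<exists>F. finite F \<and> (\<exists>j. \<forall>n\<in>C - F. decode R i n = j)" using assms(1) by (simp add: COH_def)
    then obtain F j where "finite F" "\<forall>n\<in>C - F. decode R i n = j" by (elim exE conjE)
    then show ?thesis using assms(2) by (intro exI[of _ "A \<union> F"] conjI exI[of _ j]) auto
  qed
  moreover have "infinite (A \<union> (C - {..<u}))"
    using assms by (auto simp: COH_def intro: Diff_infinite_finite)
  ultimately show ?thesis by (simp add: COH_def)
qed

lemma agree_finite:
  assumes "finite F" "\<And>x. x \<in> F \<Longrightarrow> \<exists>w. \<forall>Y\<in>K. agree w X Y \<longrightarrow> P x Y"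
  shows "\<exists>w. \<forall>Y\<in>K. agree w X Y \<longrightarrow> (\<forall>x\<in>F. P x Y)"
  using assms
proof (induction F rule: finite_induct)
  case (insert x F)
  obtain w1 where w1: "\<forall>Y\<in>K. agree w1 X Y \<longrightarrow> (\<forall>x\<in>F. P x Y)" using insert by auto
  obtain w2 where w2: "\<forall>Y\<in>K. agree w2 X Y \<longrightarrow> P x Y" using insert.prems by blast
  show ?case
  proof (intro exI ballI impI)
    fix Y y assume "Y \<in> K" "agree (max w1 w2) X Y" "y \<in> insert x F"
    moreover have "agree w1 X Y" "agree w2 X Y" using \<open>agree (max w1 w2) X Y\<close> by (auto simp: agree_def)
    ultimately show "P y Y" using w1 w2 by auto
  qed
qed simp

definition overwrite_row :: "cantor \<Rightarrow> nat \<Rightarrow> nat \<Rightarrow> bool \<Rightarrow> cantor" where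
  "overwrite_row X x m v = encode (\<lambda>a z. if a = x \<and> m \<le> z then v else decode X a z)"

lemma decode_overwrite_row [simp]: "decode (overwrite_row X x m v) a z = (if a = x \<and> m \<le> z then v else decode X a z)"
  by (simp add: overwrite_row_def)

lemma agree_overwrite_row: "agree m X (overwrite_row X x m v)"
proof -
  have "k \<in> overwrite_row X x m v \<longleftrightarrow> k \<in> X" if "k < m" for k
  proof -
    from that snd_prod_decode_le[of k] have "\<not> m \<le> snd (prod_decode k)" by simp
    then show ?thesis by (simp add: overwrite_row_def encode_def decode_def)
  qed
  then show ?thesis by (simp add: agree_def)
qed

text \<open>
  From \<open>b\<close> on, all rows of the instances in \<open>K\<close> may be made constant from any point after \<open>b\<close> on. This is
  the only freedom that the construction has to preserve.
\<close>

definition flexible :: "nat \<Rightarrow> cantor set \<Rightarrow> bool" where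
  "flexible b K \<longleftrightarrow> (\<forall>X\<in>K. \<forall>x\<ge>b. \<forall>m\<ge>b. \<forall>v. overwrite_row X x m v \<in> K)"

text \<open>
  At an instance \<open>X\<close> near which limit colors are constant, let \<open>F\<close> be the part of a homogeneous set \<open>H\<close>
  of color \<open>i\<close> that the algorithm \<open>\<psi>\<close> uses to name elements \<open>x0 < y0\<close> of its answer. Let \<open>K'\<close> consist of the
  instances near \<open>X\<close> whose row \<open>x0\<close> is eventually opposite to the color of \<open>(x0, y0)\<close>. For
  an instance in \<open>K'\<close> with infinitely many elements of limit color \<open>i\<close>, the set \<open>F\<close> would still extend to an infinite
  homogeneous set of color \<open>i\<close>, since the limit colors on \<open>F\<close> are also \<open>i\<close>, and a cohesive set may be
  given any initial segment; the algorithm would then have to name \<open>x0\<close> and \<open>y0\<close>. The witness \<open>X\<close> is recorded so that in a second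
  application the color is seen to be the other one.
\<close>

lemma killing_step:
  fixes D :: "cantor \<Rightarrow> nat \<Rightarrow> nat \<Rightarrow> bool" and R \<psi> :: "cantor \<Rightarrow> cantor"
  assumes st: "\<And>X. stable (D X)"
    and cont: "\<And>X x z. \<exists>w. \<forall>Y. agree w X Y \<longrightarrow> D Y x z = D X x z"
    and sol: "\<And>X H C i. infinite H \<Longrightarrow> monochromatic (D X) i H \<Longrightarrow> (R X, C) \<in> COH \<Longrightarrow>
        (X, \<psi> (join X (join H C))) \<in> RT22"
    and use: "\<And>Z n. n \<in> \<psi> Z \<Longrightarrow> \<exists>w. \<forall>Z'. agree w Z Z' \<longrightarrow> n \<in> \<psi> Z'"
    and K: "cantor_closed K" "K \<noteq> {}" "flexible b K"
  shows "\<exists>K' b' i X. K' \<subseteq> K \<and> cantor_closed K' \<and> K' \<noteq> {} \<and> flexible b' K' \<and>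
    X \<in> K \<and> infinite {x. has_limit (D X) x i} \<and> (\<forall>Y\<in>K'. finite {x. has_limit (D Y) x i})"
proof -
  have "\<exists>X\<in>K. \<forall>x. \<exists>w v. \<forall>Y\<in>K. agree w X Y \<longrightarrow> has_limit (D Y) x v"
  proof (rule generic_limits[OF K(1,2) _ st])
    show "\<exists>w. \<forall>Y\<in>K. agree w X Y \<longrightarrow> D Y x z = D X x z" for X x z using cont by blast
  qed
  then obtain X where X: "X \<in> K" and lim: "\<And>x. \<exists>w v. \<forall>Y\<in>K. agree w X Y \<longrightarrow> has_limit (D Y) x v" by blast
  obtain H i where H: "infinite H" "monochromatic (D X) i H" using ex_monochromatic by blast
  obtain C where C: "(R X, C) \<in> COH" using ex_cohesive by blast
  define O1 where "O1 = \<psi> (join X (join H C))"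
  have "(X, O1) \<in> RT22" unfolding O1_def by (rule sol[OF H C])
  then have "infinite O1" by (simp add: RT22_def)
  then obtain x0 where x0: "x0 \<in> O1" "b \<le> x0" by (auto simp: infinite_nat_iff_unbounded_le)
  obtain y0 where y0: "y0 \<in> O1" "x0 < y0" using \<open>infinite O1\<close> by (auto simp: infinite_nat_iff_unbounded)
  obtain w1 where w1: "\<And>Z. agree w1 (join X (join H C)) Z \<Longrightarrow> x0 \<in> \<psi> Z" using use x0(1) unfolding O1_def by blast
  obtain w2 where w2: "\<And>Z. agree w2 (join X (join H C)) Z \<Longrightarrow> y0 \<in> \<psi> Z" using use y0(1) unfolding O1_def by blast
  define u0 where "u0 = max w1 w2"
  have prod: "x0 \<in> \<psi> Z \<and> y0 \<in> \<psi> Z" if "agree u0 (join X (join H C)) Z" for Z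
    using w1 w2 that by (simp add: agree_def u0_def)
  define F where "F = H \<inter> {..<u0}"
  have finF: "finite F" by (simp add: F_def)
  have "\<exists>w. \<forall>Y\<in>K. agree w X Y \<longrightarrow> (\<forall>x\<in>F. has_limit (D Y) x i)"
  proof (rule agree_finite[OF finF])
    fix x assume "x \<in> F"
    then have xH: "x \<in> H" by (simp add: F_def)
    obtain w v where wv: "\<forall>Y\<in>K. agree w X Y \<longrightarrow> has_limit (D Y) x v" using lim by blast
    then have "finite {z. D X x z \<noteq> v}" using X by (simp add: has_limit_iff)
    then have "infinite (H - ({z. D X x z \<noteq> v} \<union> {..x}))" using H(1) by (intro Diff_infinite_finite) auto
    then obtain z where "z \<in> H - ({z. D X x z \<noteq> v} \<union> {..x})" using infinite_imp_nonempty by blast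
    \<comment> \<open>Some \<open>z\<close> in \<open>H\<close> sees both the limit color of \<open>x\<close> and the color of \<open>H\<close>.\<close>
    then have "v = i" using H(2) xH by (auto simp: monochromatic_def)
    with wv show "\<exists>w. \<forall>Y\<in>K. agree w X Y \<longrightarrow> has_limit (D Y) x i" by blast
  qed
  then obtain w3 where w3: "\<And>Y x. Y \<in> K \<Longrightarrow> agree w3 X Y \<Longrightarrow> x \<in> F \<Longrightarrow> has_limit (D Y) x i" by blast
  have "\<exists>w. \<forall>Y\<in>K. agree w X Y \<longrightarrow> (\<forall>xz\<in>F \<times> F. D Y (fst xz) (snd xz) = D X (fst xz) (snd xz))"
    by (rule agree_finite) (simp add: finF, metis cont)
  then obtain w4 where w4': "\<forall>Y\<in>K. agree w4 X Y \<longrightarrow> (\<forall>xz\<in>F \<times> F. D Y (fst xz) (snd xz) = D X (fst xz) (snd xz))" ..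
  have w4: "D Y x z = D X x z" if "Y \<in> K" "agree w4 X Y" "x \<in> F" "z \<in> F" for Y x z
    using bspec[OF w4' that(1)] that(2-4) by auto
  \<comment> \<open>Beyond the uses found so far, \<open>u\<close> has to exceed \<open>x0\<close>, so that row \<open>x0\<close> is never altered again,
    and the code of the pair \<open>(x0, y0)\<close>, so that its color is kept.\<close>
  define u where "u = Max {u0, w3, w4, b, Suc x0, Suc (prod_encode (x0, y0))}"
  have u: "u0 \<le> u" "w3 \<le> u" "w4 \<le> u" "b \<le> u" "Suc x0 \<le> u" "Suc (prod_encode (x0, y0)) \<le> u"
    by (simp_all add: u_def)
  define v where "v \<longleftrightarrow> \<not> decode X x0 y0"
  define K' where "K' = {Y \<in> K. agree u X Y \<and> (\<forall>z\<ge>u. decode Y x0 z = v)}"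
  have "K' \<noteq> {}"
  proof -
    have "overwrite_row X x0 u v \<in> K" using K(3) X x0(2) u(4) by (simp add: flexible_def)
    then have "overwrite_row X x0 u v \<in> K'" using agree_overwrite_row by (simp add: K'_def)
    then show ?thesis by blast
  qed
  moreover have "cantor_closed K'"
    unfolding cantor_closed_def
  proof (intro allI impI)
    fix Z assume Z: "\<forall>t. \<exists>Y\<in>K'. agree t Z Y"
    then have "\<forall>t. \<exists>Y\<in>K. agree t Z Y" unfolding K'_def by blast
    then have "Z \<in> K" using K(1) unfolding cantor_closed_def by blast
    moreover have "agree u X Z"
    proof -
      obtain Y where "Y \<in> K'" "agree u Z Y" using Z by blast
      then show ?thesis by (auto simp: K'_def agree_def)
    qed
    moreover have "decode Z x0 z = v" if "u \<le> z" for z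
    proof -
      obtain Y where Y: "Y \<in> K'" "agree (Suc (prod_encode (x0, z))) Z Y" using Z by blast
      then have "decode Z x0 z = decode Y x0 z" by (simp add: agree_def decode_def)
      then show ?thesis using Y(1) that by (simp add: K'_def)
    qed
    ultimately show "Z \<in> K'" by (simp add: K'_def)
  qed
  moreover have "flexible u K'"
    unfolding flexible_def
  proof (intro ballI allI impI)
    fix Y x m e assume Y: "Y \<in> K'" and xm: "u \<le> x" "u \<le> m"
    have "overwrite_row Y x m e \<in> K" using K(3) Y xm u(4) by (simp add: K'_def flexible_def)
    moreover have "agree u X (overwrite_row Y x m e)"
      using Y agree_trans[OF _ agree_mono[OF agree_overwrite_row xm(2)]] by (simp add: K'_def)
    ultimately show "overwrite_row Y x m e \<in> K'" using Y xm u(5) by (simp add: K'_def)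
  qed
  moreover have "infinite {x. has_limit (D X) x i}"
  proof -
    have "has_limit (D X) x i" if xH: "x \<in> H" for x
    proof -
      obtain j where j: "has_limit (D X) x j" using stable_limit[OF st] by blast
      then have "infinite (H - ({z. D X x z \<noteq> j} \<union> {..x}))"
        using H(1) by (intro Diff_infinite_finite) (auto simp: has_limit_iff)
      then obtain z where "z \<in> H - ({z. D X x z \<noteq> j} \<union> {..x})" using infinite_imp_nonempty by blast
      then have "j = i" using H(2) xH by (auto simp: monochromatic_def)
      with j show ?thesis by simp
    qed
    then have "H \<subseteq> {x. has_limit (D X) x i}" by blast
    then show ?thesis using H(1) infinite_super by blast
  qed
  moreover have "finite {x. has_limit (D Y) x i}" if "Y \<in> K'" for Y
  proof (rule ccontr)
    assume inf: "infinite {x. has_limit (D Y) x i}"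
    have Y: "Y \<in> K" "agree u X Y" "\<And>z. u \<le> z \<Longrightarrow> decode Y x0 z = v" using that by (auto simp: K'_def)
    have limF: "has_limit (D Y) f i" if "f \<in> F" for f using w3[OF Y(1) agree_mono[OF Y(2) u(2)] that] .
    define S where "S = F \<union> {x. has_limit (D Y) x i \<and> u0 \<le> x \<and> (\<forall>f\<in>F. D Y f x = i)}"
    have "infinite S"
    proof -
      have "infinite ({x. has_limit (D Y) x i} - ({..<u0} \<union> (\<Union>f\<in>F. {x. D Y f x \<noteq> i})))" (is "infinite ?T")
        using inf finF limF by (intro Diff_infinite_finite) (auto simp: has_limit_iff)
      moreover have "?T \<subseteq> S" by (auto simp: S_def)
      ultimately show ?thesis using infinite_super by blast
    qed
    have limS: "has_limit (D Y) x i" if "x \<in> S" for x using that limF by (auto simp: S_def)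
    define G where "G = greedy (D Y) i S"
    have "infinite G" unfolding G_def
    proof (rule infinite_greedy[OF \<open>infinite S\<close>])
      fix x assume "x \<in> S"
      then have "finite {z. D Y x z \<noteq> i}" using limS by (simp add: has_limit_iff)
      then show "finite {z \<in> S. x < z \<and> D Y x z \<noteq> i}" by (rule rev_finite_subset) auto
    qed
    have SF: "S \<inter> {..<u0} = F" by (auto simp: S_def F_def)
    have "monochromatic (D Y) i F"
      unfolding monochromatic_def
    proof (intro ballI impI)
      fix x z assume "x \<in> F" "z \<in> F" "x < z"
      then show "D Y x z = i"
        using w4[OF Y(1) agree_mono[OF Y(2) u(3)]] H(2) by (auto simp: monochromatic_def F_def)
    qed
    then have "agree u0 S G" unfolding G_def by (intro agree_greedy) (simp add: SF)
    moreover have "agree u0 H S" using SF unfolding F_def agree_def by blast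
    ultimately have HG: "agree u0 H G" by (rule agree_trans[rotated])
    obtain C0 where "(R Y, C0) \<in> COH" using ex_cohesive by blast
    then have "(R Y, (C \<inter> {..<u0}) \<union> (C0 - {..<u0})) \<in> COH" (is "(_, ?C') \<in> _") by (intro COH_finite_change) auto
    moreover have "monochromatic (D Y) i G" unfolding G_def by (rule monochromatic_greedy)
    ultimately have sol': "(Y, \<psi> (join Y (join G ?C'))) \<in> RT22" using \<open>infinite G\<close> sol by blast
    have "agree u0 C ?C'" by (auto simp: agree_def)
    then have "agree u0 (join X (join H C)) (join Y (join G ?C'))"
      using HG agree_mono[OF Y(2) u(1)] by (intro agree_join)
    from prod[OF this] have xy: "x0 \<in> \<psi> (join Y (join G ?C'))" "y0 \<in> \<psi> (join Y (join G ?C'))" by auto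
    obtain j where j: "\<forall>x\<in>\<psi> (join Y (join G ?C')). \<forall>y\<in>\<psi> (join Y (join G ?C')). x < y \<longrightarrow> decode Y x y = j"
      using sol' unfolding RT22_def homogeneous_def by auto
    have "infinite (\<psi> (join Y (join G ?C')))" using sol' by (simp add: RT22_def)
    then obtain z where z: "z \<in> \<psi> (join Y (join G ?C'))" "u \<le> z" by (auto simp: infinite_nat_iff_unbounded_le)
    have "decode Y x0 z = j" using j xy(1) z u(5) by auto
    moreover have "decode Y x0 y0 = j" using j xy y0(2) by auto
    moreover have "decode Y x0 y0 = decode X x0 y0" using Y(2) u(6) by (simp add: agree_def decode_def)
    ultimately show False using Y(3)[OF z(2)] v_def by simp
  qed
  moreover have "K' \<subseteq> K" by (auto simp: K'_def)
  ultimately show ?thesis using X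
    by (intro exI[of _ K'] exI[of _ u] exI[of _ i] exI[of _ X] conjI ballI)
qed

lemma output_open: "n \<in> output p A \<Longrightarrow> \<exists>w. \<forall>B. agree w A B \<longrightarrow> n \<in> output p B"
  unfolding output_def using eval_use[of A p "[n]" 1] by auto

lemma output_cont:
  assumes "computes p A (output p A)"
  shows "\<exists>w. \<forall>B. agree w A B \<longrightarrow> (n \<in> output p B \<longleftrightarrow> n \<in> output p A)"
proof -
  obtain v where v: "eval A p [n] = Some v" using assms by (auto simp: computes_def)
  from eval_use[OF this] obtain w where "\<forall>B. agree w A B \<longrightarrow> eval B p [n] = Some v" by blast
  then show ?thesis using v by (intro exI[of _ w]) (simp add: output_def)
qed

text \<open>
  The second application of \<open>killing_step\<close> takes place inside the class produced by the first one, in which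
  one limit color is already confined to finite sets; hence it confines the other one.
\<close>

theorem RT22_not_le_product: "\<not> RT22 \<le>\<^sub>W SRT22 \<times>\<^sub>W COH"
proof
  assume "RT22 \<le>\<^sub>W SRT22 \<times>\<^sub>W COH"
  then obtain p q where pq: "\<And>X. \<exists>X'\<in>Domain (SRT22 \<times>\<^sub>W COH). computes p X X' \<and>
     (\<forall>Y'\<in>(SRT22 \<times>\<^sub>W COH) `` {X'}. \<exists>Y\<in>RT22 `` {X}. computes q (join X Y') Y)"
    unfolding weihrauch_le_def Domain_RT22 by blast
  define D R where "D X = decode (left_part (output p X))" and "R X = right_part (output p X)" for X
  have tot: "computes p X (output p X)" and dom: "output p X \<in> Domain (SRT22 \<times>\<^sub>W COH)" for X
    using pq[of X] computes_output by auto
  have st: "stable (D X)" for X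
    using dom[of X] by (auto simp: D_def product_def SRT22_def)
  have cont: "\<exists>w. \<forall>Y. agree w X Y \<longrightarrow> D Y x z = D X x z" for X x z
    using output_cont[OF tot] by (simp add: D_def decode_def left_part_def)
  have sol: "(X, output q (join X (join H C))) \<in> RT22"
    if "infinite H" "monochromatic (D X) i H" "(R X, C) \<in> COH" for X H C i
  proof -
    have "(left_part (output p X), H) \<in> SRT22"
      using that(1,2) st[of X] by (auto simp: SRT22_def RT22_def homogeneous_iff D_def)
    then have "(join (left_part (output p X)) (right_part (output p X)), join H C) \<in> SRT22 \<times>\<^sub>W COH"
      using that(3) unfolding product_def R_def by blast
    then have Y: "join H C \<in> (SRT22 \<times>\<^sub>W COH) `` {output p X}" by (simp add: join_left_part_right_part)
    obtain X' where X': "computes p X X'"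
      "\<forall>Y'\<in>(SRT22 \<times>\<^sub>W COH) `` {X'}. \<exists>Y\<in>RT22 `` {X}. computes q (join X Y') Y"
      using pq[of X] by blast
    then obtain Z where "Z \<in> RT22 `` {X}" "computes q (join X (join H C)) Z"
      using Y computes_output[OF X'(1)] by blast
    then show ?thesis using computes_output by auto
  qed
  have step: "\<exists>K' b' i X. K' \<subseteq> K \<and> cantor_closed K' \<and> K' \<noteq> {} \<and> flexible b' K' \<and>
    X \<in> K \<and> infinite {x. has_limit (D X) x i} \<and> (\<forall>Y\<in>K'. finite {x. has_limit (D Y) x i})"
    if "cantor_closed K" "K \<noteq> {}" "flexible b K" for K b
    by (rule killing_step[where R = R and \<psi> = "output q"]) (fact st cont sol output_open that)+
  have "cantor_closed UNIV" "UNIV \<noteq> ({} :: cantor set)" "flexible 0 UNIV"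
    by (auto simp: cantor_closed_def flexible_def)
  from step[OF this] obtain K1 b1 i1 where K1: "cantor_closed K1" "K1 \<noteq> {}" "flexible b1 K1"
    "\<forall>Y\<in>K1. finite {x. has_limit (D Y) x i1}" by (elim exE conjE)
  from step[OF K1(1-3)] obtain K2 i2 X where K2: "K2 \<subseteq> K1" "K2 \<noteq> {}"
    "X \<in> K1" "infinite {x. has_limit (D X) x i2}" "\<forall>Y\<in>K2. finite {x. has_limit (D Y) x i2}" by (elim exE conjE)
  have "i1 \<noteq> i2" 
  proof
    assume "i1 = i2"
    then show False using bspec[OF K1(4) K2(3)] K2(4) by simp
  qed
  obtain Y where "Y \<in> K2" using K2(2) by blast
  then have "finite ({x. has_limit (D Y) x i1} \<union> {x. has_limit (D Y) x i2})" using K1(4) K2(1,5) by blast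
  moreover have "{x. has_limit (D Y) x i1} \<union> {x. has_limit (D Y) x i2} = UNIV"
  proof (rule UNIV_eq_I[symmetric])
    fix x
    obtain i where "has_limit (D Y) x i" using stable_limit[OF st] by blast
    moreover have "i = i1 \<or> i = i2" using \<open>i1 \<noteq> i2\<close> by auto
    ultimately show "x \<in> {x. has_limit (D Y) x i1} \<union> {x. has_limit (D Y) x i2}" by auto
  qed
  ultimately show False by simp
qed

section \<open>A basis theorem for cohesiveness\<close>

text \<open>
  Read \<open>Q e R N v\<close> as saying that an event of kind \<open>e\<close> starting at \<open>N\<close> has been observed to take place
  before \<open>v\<close>. Row \<open>e\<close> of \<open>R\<close> keeps its color on an interval beginning at \<open>N\<close> until the finite part of \<open>R\<close>
  built so far confirms the event; then the color is flipped and a new interval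
  begins. If the event always takes place eventually, then there are infinitely many intervals of
  either color that are long enough to contain it. The requirements do not interfere, since each has
  its own row and only observes the others; this is why \<open>Q\<close> may depend on all of \<open>R\<close>.
\<close>

lemma flipping_rows:
  fixes Q :: "nat \<Rightarrow> cantor \<Rightarrow> nat \<Rightarrow> nat \<Rightarrow> bool"
  assumes "\<And>e R N v. Q e R N v \<Longrightarrow> \<exists>u. \<forall>R'. agree u R R' \<longrightarrow> Q e R' N v"
  shows "\<exists>R. \<forall>e. (\<forall>N. \<exists>v. Q e R N v) \<longrightarrow>
    (\<forall>j M. \<exists>N\<ge>M. \<exists>v. Q e R N v \<and> (\<forall>n\<in>{N..<v}. decode R e n = j))"
proof -
  define fl where "fl n \<rho> s e \<longleftrightarrow> (\<exists>v\<le>n. \<forall>R'. agree n \<rho> R' \<longrightarrow> Q e R' (s e) v)"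
    for n :: nat and \<rho> :: cantor and s :: "nat \<Rightarrow> nat" and e
  \<comment> \<open>A state consists of the part of \<open>R\<close> built so far and, for each row, of its current color and the
    start of its current interval. Stage \<open>n\<close> decides the entries of column \<open>n\<close>.\<close>
  define stage :: "nat \<Rightarrow> cantor \<times> (nat \<Rightarrow> bool) \<times> (nat \<Rightarrow> nat)" where
    "stage = rec_nat ({}, \<lambda>e. False, \<lambda>e. 0) (\<lambda>n (\<rho>, c, s).
      (\<rho> \<union> {prod_encode (e, n) | e. c e \<noteq> fl n \<rho> s e}, \<lambda>e. c e \<noteq> fl n \<rho> s e, \<lambda>e. if fl n \<rho> s e then n else s e))"
  define \<rho> c s where "\<rho> n = fst (stage n)" and "c n = fst (snd (stage n))" and "s n = snd (snd (stage n))" for n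
  define flip where "flip n = fl n (\<rho> n) (s n)" for n
  have stage0: "\<rho> 0 = {}" "s 0 e = 0" for e by (simp_all add: \<rho>_def s_def stage_def)
  have stageS: "\<rho> (Suc n) = \<rho> n \<union> {prod_encode (e, n) | e. c n e \<noteq> flip n e}"
    "c (Suc n) e = (c n e \<noteq> flip n e)" "s (Suc n) e = (if flip n e then n else s n e)" for n e
    by (simp_all add: \<rho>_def s_def c_def stage_def case_prod_beta flip_def)
  define R where "R = encode (\<lambda>e n. c (Suc n) e)"
  have R: "decode R e n = c (Suc n) e" for e n by (simp add: R_def)
  have \<rho>: "prod_encode (e, m) \<in> \<rho> n \<longleftrightarrow> m < n \<and> c (Suc m) e" for e m n
    by (induction n) (auto simp: stage0 stageS less_Suc_eq)
  have \<rho>R: "agree n (\<rho> n) R" for n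
    unfolding agree_def
  proof (intro allI impI)
    fix k assume "k < n"
    obtain e m where k: "k = prod_encode (e, m)" by (metis prod.collapse prod_decode_inverse)
    then have "m < n" using \<open>k < n\<close> le_prod_encode_2[of m e] by simp
    then show "k \<in> \<rho> n \<longleftrightarrow> k \<in> R" using R by (simp add: k \<rho> decode_def)
  qed
  have inv: "s n e \<le> n \<and> (\<forall>m. s n e \<le> m \<and> m < n \<longrightarrow> decode R e m = c n e)" for n e
  proof (induction n)
    case (Suc n)
    then show ?case by (auto simp: stageS R less_Suc_eq)
  qed (simp add: stage0)
  have flip: "\<exists>v. Q e R (s n e) v \<and> (\<forall>m\<in>{s n e..<v}. decode R e m = c n e)" if fl: "flip n e" for n e
  proof -
    obtain v where "v \<le> n" "\<forall>R'. agree n (\<rho> n) R' \<longrightarrow> Q e R' (s n e) v"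
      using fl unfolding flip_def fl_def by blast
    then show ?thesis using \<rho>R inv[of n e] by (intro exI[of _ v]) auto
  qed
  have "\<exists>N\<ge>M. \<exists>v. Q e R N v \<and> (\<forall>n\<in>{N..<v}. decode R e n = j)" if total: "\<forall>N. \<exists>v. Q e R N v" for e j M
  proof -
    \<comment> \<open>The event for the current interval is confirmed by a finite part of \<open>R\<close>, and so at some stage.\<close>
    have later: "\<exists>n\<ge>a. flip n e" for a
    proof (rule ccontr)
      assume no: "\<not> ?thesis"
      have const: "s n e = s a e" if "a \<le> n" for n
        using that by (induction n rule: dec_induct) (use no in \<open>auto simp: stageS\<close>)
      obtain v where "Q e R (s a e) v" using total by blast
      then obtain u where u: "\<And>R'. agree u R R' \<Longrightarrow> Q e R' (s a e) v" using assms by blast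
      define n where "n = max a (max u v)"
      have "flip n e"
        unfolding flip_def fl_def
      proof (intro exI conjI allI impI)
        show "v \<le> n" by (simp add: n_def)
        fix R' assume "agree n (\<rho> n) R'"
        then have "agree n R R'" using \<rho>R agree_sym agree_trans by blast
        then have "agree u R R'" by (rule agree_mono) (simp add: n_def)
        moreover have "s n e = s a e" by (rule const) (simp add: n_def)
        ultimately show "Q e R' (s n e) v" using u by simp
      qed
      moreover have "a \<le> n" by (simp add: n_def)
      ultimately show False using no by blast
    qed
    obtain n1 where n1: "M \<le> n1" "flip n1 e" using later by blast
    have start: "n1 \<le> s n e" if "Suc n1 \<le> n" for n
      using that by (induction n rule: dec_induct) (auto simp: stageS n1(2))
    \<comment> \<open>Colors alternate, so color \<open>j\<close> is current at one of the flips after \<open>n1\<close>.\<close>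
    have "\<exists>n\<ge>Suc n1. flip n e \<and> c n e = j"
    proof (rule ccontr)
      assume no: "\<not> ?thesis"
      obtain n2 where n2: "Suc n1 \<le> n2" "flip n2 e" using later by blast
      have stay: "c n e = j" if "Suc n2 \<le> n" for n
        using that
      proof (induction n rule: dec_induct)
        case base
        then show ?case using no n2 by (auto simp: stageS)
      next
        case (step n)
        then have "\<not> flip n e" using no n2(1) by auto
        then show ?case using step by (simp add: stageS)
      qed
      obtain n3 where "Suc n2 \<le> n3" "flip n3 e" using later by blast
      then show False using no stay n2(1) by auto
    qed
    then obtain n where n: "Suc n1 \<le> n" "flip n e" "c n e = j" by blast
    have "M \<le> s n e" using start[OF n(1)] n1(1) by simp
    then show ?thesis using flip[OF n(2)] n(3) by blast
  qed
  then show ?thesis by blast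
qed

text \<open>
  Openness in the product of two copies of Cantor space.
\<close>

definition open2 :: "(cantor \<Rightarrow> cantor \<Rightarrow> bool) \<Rightarrow> bool" where
  "open2 E \<longleftrightarrow> (\<forall>R A. E R A \<longrightarrow> (\<exists>u. \<forall>R' A'. agree u R R' \<longrightarrow> agree u A A' \<longrightarrow> E R' A'))"

lemma open2D: "open2 E \<Longrightarrow> E R A \<Longrightarrow> \<exists>u. \<forall>R' A'. agree u R R' \<longrightarrow> agree u A A' \<longrightarrow> E R' A'"
  unfolding open2_def by blast

lemma open2_disj:
  assumes "open2 E" "open2 E'"
  shows "open2 (\<lambda>R A. E R A \<or> E' R A)"
  using assms unfolding open2_def by metis

lemma open2_ex: "(\<And>x. x \<in> X \<Longrightarrow> open2 (E x)) \<Longrightarrow> open2 (\<lambda>R A. \<exists>x\<in>X. E x R A)"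
  unfolding open2_def by metis

lemma cohesive_limit:
  assumes "(X, C) \<in> COH"
  shows "\<exists>j. finite {z \<in> C. decode X i z \<noteq> j}"
proof -
  have "\<exists>F. finite F \<and> (\<exists>j. \<forall>n\<in>C - F. decode X i n = j)" using assms by (simp add: COH_def)
  then obtain F j where "finite F" "\<forall>n\<in>C - F. decode X i n = j" by (elim exE conjE)
  then have "{z \<in> C. decode X i z \<noteq> j} \<subseteq> F" by auto
  then show ?thesis using \<open>finite F\<close> finite_subset by blast
qed

text \<open>
  Sequential compactness: a set cohesive for the sets \<open>{v. i \<in> A v}\<close> is a set of indices along which
  the sequence converges. The bound \<open>u \<le> v\<close> is for diagonal arguments, in which \<open>A v\<close> is good only up
  to \<open>v\<close>.
\<close>

lemma cantor_compact: "\<exists>B. \<forall>u. \<exists>v\<ge>u. agree u B (A v)"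
proof -
  obtain C where C: "(encode (\<lambda>i v. i \<in> A v), C) \<in> COH" using ex_cohesive by blast
  then have inf: "infinite C" by (simp add: COH_def)
  have "\<forall>i. \<exists>j. finite {v \<in> C. (i \<in> A v) \<noteq> j}" using cohesive_limit[OF C] by simp
  from choice[OF this] obtain f where f: "\<And>i. finite {v \<in> C. (i \<in> A v) \<noteq> f i}" by blast
  have "\<exists>v\<ge>u. agree u {i. f i} (A v)" for u
  proof -
    have "infinite (C - ({..<u} \<union> (\<Union>i<u. {v \<in> C. (i \<in> A v) \<noteq> f i})))"
      using inf f by (intro Diff_infinite_finite) auto
    then obtain v where "v \<in> C - ({..<u} \<union> (\<Union>i<u. {v \<in> C. (i \<in> A v) \<noteq> f i}))"
      using infinite_imp_nonempty by blast
    then show ?thesis by (intro exI[of _ v]) (auto simp: agree_def)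
  qed
  then show ?thesis by blast
qed

text \<open>
  The proof resembles that of the hyperimmune-free basis theorem. A finite list \<open>L\<close> of pairs \<open>(k, N)\<close> cuts
  down a class to those \<open>A\<close> for which \<open>\<Gamma> k R A\<close> has no elements from \<open>N\<close> on. Processing the functionals one by
  one, \<open>\<Gamma> k\<close> is made finite in this way if the class stays nonempty for some \<open>N\<close>. Otherwise, by
  compactness, for each \<open>N\<close> there is a \<open>v\<close> such that \<open>\<Gamma> k R A\<close> has an element in \<open>{N..<v}\<close> for all
  \<open>A\<close> in the class, and this is confirmed by a finite part of \<open>R\<close>. Then \<open>flipping_rows\<close>
  provides a row of \<open>R\<close> that takes either color on infinitely many of these intervals, so \<open>\<Gamma> k R A\<close>
  is not cohesive for this row. As the possible lists are countable in number, \<open>R\<close> can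
  be chosen in advance.
\<close>

theorem non_cohesive_basis:
  fixes M :: "nat \<Rightarrow> cantor \<Rightarrow> cantor \<Rightarrow> bool" and \<Gamma> :: "nat \<Rightarrow> cantor \<Rightarrow> cantor \<Rightarrow> cantor"
  assumes M: "\<And>m. open2 (\<lambda>R A. \<not> M m R A)" and \<Gamma>: "\<And>k n. open2 (\<lambda>R A. n \<in> \<Gamma> k R A)"
  shows "\<exists>R. \<forall>m. (\<exists>A. M m R A) \<longrightarrow> (\<exists>A. M m R A \<and> (\<forall>k. (R, \<Gamma> k R A) \<notin> COH))"
proof -
  define T where "T m L R A \<longleftrightarrow> M m R A \<and> (\<forall>kN\<in>set L. \<forall>n\<in>{snd kN..}. n \<notin> \<Gamma> (fst kN) R A)"
    for m and L :: "(nat \<times> nat) list" and R A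
  have T: "open2 (\<lambda>R A. \<not> T m L R A)" for m L
  proof -
    have "(\<lambda>R A. \<not> T m L R A) = (\<lambda>R A. \<not> M m R A \<or> (\<exists>kN\<in>set L. \<exists>n\<in>{snd kN..}. n \<in> \<Gamma> (fst kN) R A))"
      by (auto simp: T_def fun_eq_iff)
    then show ?thesis using M \<Gamma> by (simp only:) (intro open2_disj open2_ex)
  qed
  define Q where "Q m k L R N v \<longleftrightarrow> (\<exists>u. \<forall>R' A. agree u R R' \<longrightarrow> T m L R' A \<longrightarrow> (\<exists>n\<in>{N..<v}. n \<in> \<Gamma> k R' A))"
    for m k L R N v
  define Q' where "Q' e = (case from_nat e of (m, k, L) \<Rightarrow> Q m k L)" for e :: nat
  have "\<exists>u. \<forall>R'. agree u R R' \<longrightarrow> Q' e R' N v" if "Q' e R N v" for e R N v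
    using that agree_trans unfolding Q'_def Q_def by (auto split: prod.splits) blast
  from flipping_rows[of Q', OF this] obtain R where "\<forall>e. (\<forall>N. \<exists>v. Q' e R N v) \<longrightarrow>
      (\<forall>j b. \<exists>N\<ge>b. \<exists>v. Q' e R N v \<and> (\<forall>n\<in>{N..<v}. decode R e n = j))" ..
  then have R: "\<exists>N\<ge>b. \<exists>v. Q' e R N v \<and> (\<forall>n\<in>{N..<v}. decode R e n = j)"
    if "\<forall>N. \<exists>v. Q' e R N v" for e j b using that by simp
  \<comment> \<open>Counterexamples for all \<open>v\<close> would accumulate at a member of the smaller class.\<close>
  have total: "\<exists>v. Q m k L R N v" if no: "\<And>A. \<not> T m ((k, N) # L) R A" for m k L N
  proof (rule ccontr)
    assume "\<not> ?thesis"
    then have "\<forall>v. \<exists>p. agree v R (fst p) \<and> T m L (fst p) (snd p) \<and> (\<forall>n\<in>{N..<v}. n \<notin> \<Gamma> k (fst p) (snd p))"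
      unfolding Q_def by simp
    from choice[OF this] obtain p where p: "\<And>v. agree v R (fst (p v))" "\<And>v. T m L (fst (p v)) (snd (p v))"
      "\<And>v n. n \<in> {N..<v} \<Longrightarrow> n \<notin> \<Gamma> k (fst (p v)) (snd (p v))" by blast
    obtain B where B: "\<And>u. \<exists>v\<ge>u. agree u B (snd (p v))" using cantor_compact[of "\<lambda>v. snd (p v)"] by blast
    have "T m L R B"
    proof (rule ccontr)
      assume "\<not> T m L R B"
      from open2D[OF T this] obtain u where u: "\<And>R' A'. agree u R R' \<Longrightarrow> agree u B A' \<Longrightarrow> \<not> T m L R' A'" by blast
      obtain v where "v \<ge> u" "agree u B (snd (p v))" using B by blast
      then show False using u[OF agree_mono[OF p(1)]] p(2) by blast
    qed
    moreover have "n \<notin> \<Gamma> k R B" if "N \<le> n" for n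
    proof
      assume "n \<in> \<Gamma> k R B"
      from open2D[OF \<Gamma> this] obtain u where u: "\<And>R' A'. agree u R R' \<Longrightarrow> agree u B A' \<Longrightarrow> n \<in> \<Gamma> k R' A'" by blast
      obtain v where v: "v \<ge> max u (Suc n)" "agree (max u (Suc n)) B (snd (p v))" using B by blast
      have "n \<in> \<Gamma> k (fst (p v)) (snd (p v))"
        using v by (intro u agree_mono[OF p(1)] agree_mono[OF v(2)]) auto
      then show False using p(3)[of n v] v(1) that by auto
    qed
    ultimately have "T m ((k, N) # L) R B" by (simp add: T_def)
    then show False using no by blast
  qed
  have "\<exists>A. M m R A \<and> (\<forall>k. (R, \<Gamma> k R A) \<notin> COH)" if A0: "M m R A0" for m A0
  proof -
    define L where "L = rec_nat [] (\<lambda>k L. if \<exists>N A. T m ((k, N) # L) R A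
      then (k, SOME N. \<exists>A. T m ((k, N) # L) R A) # L else L)"
    have L0: "L 0 = []" by (simp add: L_def)
    have LS: "L (Suc k) = (if \<exists>N A. T m ((k, N) # L k) R A
      then (k, SOME N. \<exists>A. T m ((k, N) # L k) R A) # L k else L k)" for k by (simp add: L_def)
    have "\<exists>A. T m (L k) R A" for k
    proof (induction k)
      case 0
      then show ?case using A0 by (auto simp: L0 T_def)
    next
      case (Suc k)
      then show ?case using someI_ex[of "\<lambda>N. \<exists>A. T m ((k, N) # L k) R A"] by (auto simp: LS)
    qed
    then have "\<forall>k. \<exists>A. T m (L k) R A" ..
    from choice[OF this] obtain f where f: "\<And>k. T m (L k) R (f k)" by blast
    obtain B where B: "\<And>u. \<exists>v\<ge>u. agree u B (f v)" using cantor_compact[of f] by blast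
    have mono: "set (L k) \<subseteq> set (L v)" if "k \<le> v" for k v
      using that by (induction v rule: dec_induct) (auto simp: LS)
    have TB: "T m (L k) R B" for k
    proof (rule ccontr)
      assume "\<not> T m (L k) R B"
      from open2D[OF T this] obtain u where u: "\<And>R' A'. agree u R R' \<Longrightarrow> agree u B A' \<Longrightarrow> \<not> T m (L k) R' A'" by blast
      obtain v where v: "v \<ge> max u k" "agree (max u k) B (f v)" using B by blast
      have "\<not> T m (L k) R (f v)" using v by (intro u agree_mono[OF v(2)]) auto
      moreover have "set (L k) \<subseteq> set (L v)" using v(1) by (intro mono) simp
      ultimately show False using f[of v] by (auto simp: T_def)
    qed
    have "(R, \<Gamma> k R B) \<notin> COH" for k
    proof (cases "\<exists>N A. T m ((k, N) # L k) R A")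
      case True
      then have "(k, SOME N. \<exists>A. T m ((k, N) # L k) R A) \<in> set (L (Suc k))" by (simp add: LS)
      then obtain N where "(k, N) \<in> set (L (Suc k))" by blast
      then have "\<forall>n\<in>{N..}. n \<notin> \<Gamma> k R B" using TB[of "Suc k"] by (force simp: T_def)
      then have "\<Gamma> k R B \<subseteq> {..<N}" by (metis atLeast_iff lessThan_iff not_le subsetI)
      then show ?thesis using finite_subset by (auto simp: COH_def)
    next
      case False
      define e where "e = to_nat (m, k, L k)"
      have Q': "Q' e = Q m k (L k)" by (simp add: Q'_def e_def)
      have tot: "\<forall>N. \<exists>v. Q' e R N v" using total False by (simp add: Q')
      show ?thesis
      proof
        assume "(R, \<Gamma> k R B) \<in> COH"
        from cohesive_limit[OF this] obtain j where fin: "finite {z \<in> \<Gamma> k R B. decode R e z \<noteq> j}" by blast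
        then obtain b where b: "\<And>z. z \<in> \<Gamma> k R B \<Longrightarrow> decode R e z \<noteq> j \<Longrightarrow> z < b"
          by (auto simp: finite_nat_set_iff_bounded)
        obtain N v where N: "N \<ge> b" "Q m k (L k) R N v" "\<forall>n\<in>{N..<v}. decode R e n = (\<not> j)"
          using R[OF tot, of b "\<not> j"] by (auto simp: Q')
        then obtain n where "n \<in> {N..<v}" "n \<in> \<Gamma> k R B"
          using TB[of k] agree_refl unfolding Q_def by blast
        then show False using b[of n] N(1,3) by auto
      qed
    qed
    moreover have "M m R B" using TB[of 0] by (simp add: T_def)
    ultimately show ?thesis by blast
  qed
  then show ?thesis by blast
qed

text \<open>
  The set \<open>res S i G\<close> contains the elements of \<open>S\<close> above \<open>G\<close> that have the color opposite to \<open>i\<close> with all elements of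
  \<open>G\<close>. If every such set that is infinite contained an \<open>x\<close> whose addition to \<open>G\<close> leaves it infinite,
  then the elements \<open>x\<close> added one after the other would form an infinite set of the
  opposite color. Hence for some \<open>G\<close> all elements of the reservoir have limit color \<open>i\<close> within it, and the
  greedy procedure does not get stuck.
\<close>

lemma ex_infinite_greedy:
  fixes d :: "nat \<Rightarrow> nat \<Rightarrow> bool"
  defines "res \<equiv> \<lambda>S i G. {z \<in> S. \<forall>g\<in>set G. g < z \<and> d g z \<noteq> i}"
  assumes inf: "infinite (res S i G0)"
    and no: "\<And>H. infinite H \<Longrightarrow> H \<subseteq> res S i G0 \<Longrightarrow> \<not> monochromatic d (\<not> i) H"
  shows "\<exists>G. infinite (greedy d i (res S i G))"
proof (rule ccontr)
  assume fin: "\<not> ?thesis"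
  define good where "good G \<longleftrightarrow> set G0 \<subseteq> set G \<and> infinite (res S i G)" for G
  have "\<exists>G. \<forall>n. good (G n) \<and> (\<exists>x\<in>res S i (G n). G (Suc n) = x # G n)"
  proof (rule dependent_nat_choice)
    show "\<exists>G. good G" using inf by (auto simp: good_def)
    fix G and n :: nat assume G: "good G"
    have "\<exists>x\<in>res S i G. infinite (res S i (x # G))"
    proof (rule ccontr)
      assume "\<not> ?thesis"
      then have "finite {z \<in> res S i G. x < z \<and> d x z \<noteq> i}" if "x \<in> res S i G" for x
        using that by (auto simp: res_def conj_ac elim!: rev_finite_subset)
      from infinite_greedy[OF _ this] G fin show False by (auto simp: good_def)
    qed
    then obtain x where "x \<in> res S i G" "infinite (res S i (x # G))" by blast
    then show "\<exists>G'. good G' \<and> (\<exists>x\<in>res S i G. G' = x # G)"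
      using G by (intro exI[of _ "x # G"]) (auto simp: good_def)
  qed
  then obtain G where G': "\<forall>n. good (G n) \<and> (\<exists>x\<in>res S i (G n). G (Suc n) = x # G n)" ..
  then have G: "\<And>n. good (G n)" "\<forall>n. \<exists>x. x \<in> res S i (G n) \<and> G (Suc n) = x # G n"
    by (simp_all add: Bex_def)
  from choice[OF G(2)] obtain x where x: "\<And>n. x n \<in> res S i (G n)" "\<And>n. G (Suc n) = x n # G n" by blast
  have mem: "x m \<in> set (G n)" if "Suc m \<le> n" for m n
    using that by (induction n rule: dec_induct) (auto simp: x(2))
  then have lt: "x m < x n \<and> d (x m) (x n) \<noteq> i" if "m < n" for m n
    using x(1)[of n] that by (auto simp: res_def)
  then have "strict_mono x" by (simp add: strict_mono_def)
  then have "infinite (range x)" by (simp add: range_inj_infinite strict_mono_imp_inj_on)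
  moreover have "range x \<subseteq> res S i G0"
    using x(1) G(1) by (auto simp: res_def good_def)
  moreover have "monochromatic d (\<not> i) (range x)"
    using lt \<open>strict_mono x\<close> by (auto simp: monochromatic_def strict_mono_less)
  ultimately show False using no by blast
qed

section \<open>The product does not reduce to Ramsey's theorem\<close>

text \<open>
  The coloring that is constant as long as only numbers below \<open>s\<close> have been considered, and then gives every
  element below \<open>s\<close> the other limit color. For \<open>s = 0\<close> it is constant.
\<close>

definition switch_coloring :: "nat \<Rightarrow> cantor" where
  "switch_coloring s = encode (\<lambda>x z. x < s \<and> s \<le> z)"

lemma decode_switch_coloring [simp]: "decode (switch_coloring s) x z \<longleftrightarrow> x < s \<and> s \<le> z"
  by (simp add: switch_coloring_def)

lemma stable_switch_coloring: "stable (decode (switch_coloring s))"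
  unfolding stable_def eventually_sequentially decode_switch_coloring
  by (intro allI exI[of _ "_ < s"] exI[of _ s]) auto

lemma agree_switch_coloring: "agree s (switch_coloring 0) (switch_coloring s)"
proof -
  have "\<not> s \<le> snd (prod_decode k)" if "k < s" for k using that snd_prod_decode_le[of k] by simp
  then show ?thesis by (auto simp: agree_def switch_coloring_def encode_def)
qed

lemma agree_finite_UNIV:
  assumes "finite F" "\<And>x. x \<in> F \<Longrightarrow> \<exists>w. \<forall>Y. agree w X Y \<longrightarrow> P x Y"
  shows "\<exists>w. \<forall>Y. agree w X Y \<longrightarrow> (\<forall>x\<in>F. P x Y)"
  using agree_finite[of F UNIV X P] assms by simp

theorem product_not_le_RT22: "\<not> SRT22 \<times>\<^sub>W COH \<le>\<^sub>W RT22"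
proof
  assume "SRT22 \<times>\<^sub>W COH \<le>\<^sub>W RT22"
  then obtain p q where pq: "\<And>X. X \<in> Domain (SRT22 \<times>\<^sub>W COH) \<Longrightarrow> \<exists>X'\<in>Domain RT22. computes p X X' \<and>
     (\<forall>H\<in>RT22 `` {X'}. \<exists>Y\<in>(SRT22 \<times>\<^sub>W COH) `` {X}. computes q (join X H) Y)"
    unfolding weihrauch_le_def by blast
  define X where "X s R = join (switch_coloring s) R" for s R
  define d where "d s R = decode (output p (X s R))" for s R
  define O1 where "O1 s R H = output q (join (X s R) H)" for s R H
  have inst: "X s R \<in> Domain (SRT22 \<times>\<^sub>W COH)" for s R
  proof -
    have "switch_coloring s \<in> Domain SRT22" by (simp add: Domain_SRT22 stable_switch_coloring)
    moreover have "R \<in> Domain COH" by (simp add: Domain_COH)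
    ultimately show ?thesis unfolding product_def X_def by blast
  qed
  have tot: "computes p (X s R) (output p (X s R))" for s R
    using pq[OF inst] computes_output by metis
  have sol: "\<exists>Y0. O1 s R H = join Y0 (right_part (O1 s R H)) \<and> infinite Y0 \<and> homogeneous (decode (switch_coloring s)) Y0
      \<and> (R, right_part (O1 s R H)) \<in> COH"
    if H: "infinite H" "monochromatic (d s R) i H" for s R H i
  proof -
    obtain X' where X': "computes p (X s R) X'"
      "\<forall>H\<in>RT22 `` {X'}. \<exists>Y\<in>(SRT22 \<times>\<^sub>W COH) `` {X s R}. computes q (join (X s R) H) Y"
      using pq[OF inst] by blast
    have "H \<in> RT22 `` {X'}"
      using H computes_output[OF X'(1)] by (auto simp: RT22_def homogeneous_iff d_def)
    then obtain Y where Y: "(X s R, Y) \<in> SRT22 \<times>\<^sub>W COH" "computes q (join (X s R) H) Y"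
      using X'(2) by blast
    have "Y = O1 s R H" using computes_output[OF Y(2)] by (simp add: O1_def)
    with Y(1) show ?thesis by (auto simp: product_def X_def SRT22_def RT22_def)
  qed
  have d_cont: "\<exists>w. \<forall>Y. agree w (X s R) Y \<longrightarrow> (\<forall>xz\<in>F. decode (output p Y) (fst xz) (snd xz) = d s R (fst xz) (snd xz))"
    if "finite F" for s R F
    using that output_cont[OF tot] by (intro agree_finite_UNIV) (simp_all add: d_def decode_def)
  have agree_X: "agree w (X s R) (X s R')" if "agree w R R'" for w s R R'
    using that by (simp add: X_def agree_join)

  \<comment> \<open>\<open>\<Gamma> k\<close> applies the algorithm to a greedy homogeneous set of color \<open>i\<close> and retains the cohesive set;
    its index \<open>k\<close> codes which coloring is used and the parameters of the greedy set. The greedy set is drawn from \<open>A\<close> for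
    color 0 and from its complement for color 1, according to the color that may be missing there.\<close>
  define res where "res i d A G = {z. (z \<in> A) = (\<not> i) \<and> (\<forall>g\<in>set G. g < z \<and> d g z \<noteq> i)}"
    for i and d :: "nat \<Rightarrow> nat \<Rightarrow> bool" and A :: cantor and G
  define gr where "gr s i G R A = greedy (d s R) i (res i (d s R) A G)" for s i G R A
  define \<Gamma> where "\<Gamma> k R A = (case from_nat k of (s, i, G) \<Rightarrow> right_part (O1 s R (gr s i G R A)))" for k :: nat and R A
  define bad where "bad R A \<longleftrightarrow> (\<exists>F x y u i. F \<subseteq> {..<u} \<and> x < y \<and>
      (\<forall>Z. agree u (join (X 0 R) F) Z \<longrightarrow> 2 * x \<in> output q Z \<and> 2 * y \<in> output q Z) \<and>
      monochromatic (d 0 R) i F \<and> (\<forall>f\<in>F. f \<in> A \<longleftrightarrow> i))" for R A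
  \<comment> \<open>The basis theorem is applied to the class of sets \<open>A\<close> that are not \<open>bad\<close>, and to the two
    singletons that leave the reservoir of the greedy set unrestricted.\<close>
  define M where "M m R A \<longleftrightarrow> (if m = 0 then \<not> bad R A else A = (if m = 1 then UNIV else {}))"
    for m :: nat and R A

  have "open2 bad"
    unfolding open2_def
  proof (intro allI impI)
    fix R A assume "bad R A"
    then obtain F x y u i where b: "F \<subseteq> {..<u}" "x < y"
      "\<And>Z. agree u (join (X 0 R) F) Z \<Longrightarrow> 2 * x \<in> output q Z \<and> 2 * y \<in> output q Z"
      "monochromatic (d 0 R) i F" "\<forall>f\<in>F. f \<in> A \<longleftrightarrow> i"
      unfolding bad_def by (elim exE conjE) simp
    have "finite (F \<times> F)" using b(1) finite_subset by auto
    from d_cont[OF this] obtain w where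
      w: "\<And>Y. agree w (X 0 R) Y \<Longrightarrow> \<forall>xz\<in>F \<times> F. decode (output p Y) (fst xz) (snd xz) = d 0 R (fst xz) (snd xz)"
      by blast
    have "bad R' A'" if R': "agree (max u w) R R'" and A': "agree (max u w) A A'" for R' A'
      unfolding bad_def
    proof (intro exI conjI allI impI)
      have *: "\<forall>xz\<in>F \<times> F. d 0 R' (fst xz) (snd xz) = d 0 R (fst xz) (snd xz)"
        unfolding d_def[of 0 R'] by (rule w) (rule agree_X, rule agree_mono[OF R'], simp)
      then show "monochromatic (d 0 R') i F" using b(4) by (auto simp: monochromatic_def)
      show "\<forall>f\<in>F. f \<in> A' \<longleftrightarrow> i"
      proof
        fix f assume f: "f \<in> F"
        then have "f < max u w" using b(1) by auto
        then show "f \<in> A' \<longleftrightarrow> i" using bspec[OF b(5) f] agreeD[OF A', of f] by blast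
      qed
      fix Z assume "agree u (join (X 0 R') F) Z"
      moreover have "agree u (join (X 0 R) F) (join (X 0 R') F)"
        by (intro agree_join agree_X agree_mono[OF R']) simp_all
      ultimately have "agree u (join (X 0 R) F) Z" using agree_trans by blast
      then show "2 * x \<in> output q Z" "2 * y \<in> output q Z" using b(3) by auto
    qed (use b in auto)
    then show "\<exists>u. \<forall>R' A'. agree u R R' \<longrightarrow> agree u A A' \<longrightarrow> bad R' A'" by blast
  qed
  moreover have "open2 (\<lambda>R A. A \<noteq> B)" for B
    unfolding open2_def
  proof (intro allI impI)
    fix R A assume "A \<noteq> B"
    then obtain n where "(n \<in> A) \<noteq> (n \<in> B)" by blast
    then show "\<exists>u. \<forall>R' A'. agree u R R' \<longrightarrow> agree u A A' \<longrightarrow> A' \<noteq> B"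
      by (intro exI[of _ "Suc n"]) (auto simp: agree_def)
  qed
  ultimately have M_open: "open2 (\<lambda>R A. \<not> M m R A)" for m
    by (cases "m = 0") (simp_all add: M_def)

  have \<Gamma>_open: "open2 (\<lambda>R A. n \<in> \<Gamma> k R A)" for n k
    unfolding open2_def
  proof (intro allI impI)
    fix R A assume n: "n \<in> \<Gamma> k R A"
    obtain s :: nat and i :: bool and G :: "nat list" where k: "from_nat k = (s, i, G)" by (metis prod_cases3)
    from n have "Suc (2 * n) \<in> output q (join (X s R) (gr s i G R A))" by (simp add: \<Gamma>_def k O1_def right_part_def)
    from output_open[OF this] obtain u where
      u: "\<And>Z. agree u (join (X s R) (gr s i G R A)) Z \<Longrightarrow> Suc (2 * n) \<in> output q Z" by blast
    have "finite ({..<u} \<times> {..<u})" by simp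
    from d_cont[OF this] obtain w where
      w: "\<And>Y. agree w (X s R) Y \<Longrightarrow> \<forall>xz\<in>{..<u} \<times> {..<u}. decode (output p Y) (fst xz) (snd xz) = d s R (fst xz) (snd xz)"
      by blast
    have "n \<in> \<Gamma> k R' A'" if R': "agree (max u w) R R'" and A': "agree (max u w) A A'" for R' A'
    proof -
      have "\<forall>xz\<in>{..<u} \<times> {..<u}. d s R' (fst xz) (snd xz) = d s R (fst xz) (snd xz)"
        unfolding d_def[of s R'] by (rule w) (rule agree_X, rule agree_mono[OF R'], simp)
      then have dd: "d s R x z = d s R' x z" if "x < u" "z < u" for x z using that by auto
      have "agree u (gr s i G R A) (gr s i G R' A')"
        unfolding gr_def
      proof (rule greedy_cong)
        fix z assume z: "z < u"
        then have "z \<in> A \<longleftrightarrow> z \<in> A'" using A' by (simp add: agree_def)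
        then show "z \<in> res i (d s R) A G \<longleftrightarrow> z \<in> res i (d s R') A' G"
          using dd[OF less_trans[OF _ z] z] by (auto simp: res_def)
      qed (use dd in auto)
      then have "agree u (join (X s R) (gr s i G R A)) (join (X s R') (gr s i G R' A'))"
        by (intro agree_join agree_X agree_mono[OF R']) simp_all
      from u[OF this] show ?thesis by (simp add: \<Gamma>_def k O1_def right_part_def)
    qed
    then show "\<exists>u. \<forall>R' A'. agree u R R' \<longrightarrow> agree u A A' \<longrightarrow> n \<in> \<Gamma> k R' A'" by blast
  qed

  from non_cohesive_basis[of M \<Gamma>, OF M_open \<Gamma>_open] obtain R where
    "\<forall>m. (\<exists>A. M m R A) \<longrightarrow> (\<exists>A. M m R A \<and> (\<forall>k. (R, \<Gamma> k R A) \<notin> COH))" ..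
  then have R: "\<exists>A. M m R A \<and> (\<forall>k. (R, \<Gamma> k R A) \<notin> COH)" if "\<exists>A. M m R A" for m
    using that by simp

  \<comment> \<open>A reservoir without infinite homogeneous sets of the color opposite to \<open>i\<close> yields a cohesive set.\<close>
  have cohesive: "\<exists>k. (R, \<Gamma> k R A) \<in> COH"
    if inf: "infinite (res i (d s R) A G0)"
      and no: "\<And>H. infinite H \<Longrightarrow> H \<subseteq> res i (d s R) A G0 \<Longrightarrow> \<not> monochromatic (d s R) (\<not> i) H" for i s A G0
  proof -
    have eq: "res i (d s R) A G = {z \<in> {z. (z \<in> A) = (\<not> i)}. \<forall>g\<in>set G. g < z \<and> d s R g z \<noteq> i}" for G
      by (auto simp: res_def)
    have "\<exists>G. infinite (greedy (d s R) i (res i (d s R) A G))"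
      unfolding eq by (rule ex_infinite_greedy) (use inf no in \<open>simp_all add: eq\<close>)
    then obtain G where "infinite (gr s i G R A)" by (auto simp: gr_def)
    moreover have "monochromatic (d s R) i (gr s i G R A)" by (simp add: gr_def monochromatic_greedy)
    ultimately have "(R, right_part (O1 s R (gr s i G R A))) \<in> COH" using sol by blast
    then have "(R, \<Gamma> (to_nat (s, i, G)) R A) \<in> COH" by (simp add: \<Gamma>_def)
    then show ?thesis by blast
  qed

  \<comment> \<open>\<open>A s\<close> records the limit colors, along a set \<open>C s\<close>, of the coloring obtained from the one
    that changes at \<open>s\<close>. An accumulation point \<open>B\<close> of these sets is not bad: the pair \<open>x < y\<close> named on
    account of \<open>F\<close> would also be named for some large \<open>s\<close>, at which \<open>C s\<close> provides infinitely many one-point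
    extensions of \<open>F\<close> although the change at \<open>s\<close> leaves no infinite one.\<close>
  have "\<exists>A. M 0 R A"
  proof -
    have "\<forall>s. \<exists>C. (output p (X s R), C) \<in> COH" using ex_cohesive by blast
    from choice[OF this] obtain C where C: "\<And>s. (output p (X s R), C s) \<in> COH" by blast
    define A where "A s = {x. finite {z \<in> C s. d s R x z \<noteq> True}}" for s
    have A: "finite {z \<in> C s. d s R x z \<noteq> (x \<in> A s)}" for s x
    proof -
      obtain j where j: "finite {z \<in> C s. d s R x z \<noteq> j}"
        using cohesive_limit[OF C] unfolding d_def by blast
      show ?thesis
      proof (cases "x \<in> A s")
        case False
        then have "j = False" using j by (auto simp: A_def)
        then show ?thesis using j False by simp
      qed (simp add: A_def)
    qed
    obtain B where B: "\<And>u. \<exists>s\<ge>u. agree u B (A s)" using cantor_compact[of A] by blast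
    have "\<not> bad R B"
    proof
      assume "bad R B"
      then obtain F x y u i where b: "F \<subseteq> {..<u}" "x < y"
        "\<And>Z. agree u (join (X 0 R) F) Z \<Longrightarrow> 2 * x \<in> output q Z \<and> 2 * y \<in> output q Z"
        "monochromatic (d 0 R) i F" "\<forall>f\<in>F. f \<in> B \<longleftrightarrow> i"
        unfolding bad_def by (elim exE conjE) simp
      have finF: "finite F" using b(1) finite_subset by auto
      then have "finite (F \<times> F)" by simp
      from d_cont[OF this] obtain w where
        w: "\<And>Y. agree w (X 0 R) Y \<Longrightarrow> \<forall>xz\<in>F \<times> F. decode (output p Y) (fst xz) (snd xz) = d 0 R (fst xz) (snd xz)"
        by blast
      define t where "t = max (max u w) (Suc y)"
      obtain s where s: "t \<le> s" "agree t B (A s)" using B by blast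
      have X0: "agree s (X 0 R) (X s R)" unfolding X_def by (intro agree_join agree_switch_coloring agree_refl)
      have "\<forall>xz\<in>F \<times> F. d s R (fst xz) (snd xz) = d 0 R (fst xz) (snd xz)"
        unfolding d_def[of s R] by (intro w agree_mono[OF X0]) (use s(1) in \<open>simp add: t_def\<close>)
      then have monoF: "monochromatic (d s R) i F" using b(4) by (auto simp: monochromatic_def)
      have lim: "finite {z \<in> C s. d s R f z \<noteq> i}" if "f \<in> F" for f
      proof -
        have "f < t" using b(1) that by (auto simp: t_def)
        then have "f \<in> A s \<longleftrightarrow> i" using bspec[OF b(5) that] agreeD[OF s(2), of f] by blast
        then show ?thesis using A[of s f] by simp
      qed
      obtain G0 where G0: "set G0 = F" using finF finite_list by blast
      define U :: cantor where "U = (if i then UNIV else {})"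
      have U: "(z \<in> U) = (\<not> \<not> i)" for z by (simp add: U_def)
      have "\<exists>k. (R, \<Gamma> k R U) \<in> COH"
      proof (rule cohesive)
        have "infinite (C s)" using C[of s] by (simp add: COH_def)
        then have "infinite (C s - ({..<u} \<union> (\<Union>f\<in>F. {z \<in> C s. d s R f z \<noteq> i})))" (is "infinite ?T")
          using finF lim by (intro Diff_infinite_finite) auto
        moreover have "?T \<subseteq> res (\<not> i) (d s R) U G0"
          using b(1) by (auto simp: res_def U G0)
        ultimately show "infinite (res (\<not> i) (d s R) U G0)" using infinite_super by blast
        fix H assume H: "infinite H" "H \<subseteq> res (\<not> i) (d s R) U G0"
        show "\<not> monochromatic (d s R) (\<not> \<not> i) H"
        proof
          assume mono: "monochromatic (d s R) (\<not> \<not> i) H"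
          define H' where "H' = F \<union> (H - {..<u})"
          have infH': "infinite H'" using H(1) by (simp add: H'_def)
          have FH: "d s R f h = i" if "f \<in> F" "h \<in> H" for f h using H(2) that by (auto simp: res_def G0)
          have "monochromatic (d s R) i H'"
            unfolding monochromatic_def
          proof (intro ballI impI)
            fix a c assume "a \<in> H'" "c \<in> H'" "a < c"
            then consider "a \<in> F" "c \<in> F" | "a \<in> F" "c \<in> H" | "a \<in> H" "c \<in> H"
              using b(1) by (force simp: H'_def)
            then show "d s R a c = i"
              using monoF mono FH \<open>a < c\<close> by cases (auto simp: monochromatic_def)
          qed
          from sol[OF infH' this] obtain Y0 where Y0: "O1 s R H' = join Y0 (right_part (O1 s R H'))"
            "infinite Y0" "homogeneous (decode (switch_coloring s)) Y0" by blast
          have "agree u F H'" using b(1) by (auto simp: agree_def H'_def)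
          then have "agree u (join (X 0 R) F) (join (X s R) H')"
            by (intro agree_join agree_mono[OF X0]) (use s(1) in \<open>simp_all add: t_def\<close>)
          from b(3)[OF this] have "2 * x \<in> O1 s R H'" "2 * y \<in> O1 s R H'" by (simp_all add: O1_def)
          then have xy: "x \<in> Y0" "y \<in> Y0" by (metis Y0(1) join_even)+
          obtain z where z: "z \<in> Y0" "s \<le> z" using Y0(2) by (auto simp: infinite_nat_iff_unbounded_le)
          have ys: "y < s" using s(1) by (simp add: t_def)
          obtain j where j: "\<forall>a\<in>Y0. \<forall>c\<in>Y0. a < c \<longrightarrow> decode (switch_coloring s) a c = j"
            using Y0(3) unfolding homogeneous_def ..
          \<comment> \<open>\<open>(x, y)\<close> is colored before the change and \<open>(x, z)\<close> after it.\<close>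
          have "decode (switch_coloring s) x y = j" using j xy b(2) by blast
          moreover have "decode (switch_coloring s) x z = j" using j xy z b(2) ys by (meson less_le_trans less_trans)
          ultimately show False using ys b(2) z(2) by simp
        qed
      qed
      moreover have "\<exists>A. M (if i then 1 else 2) R A" by (simp add: M_def)
      then have "\<forall>k. (R, \<Gamma> k R U) \<notin> COH" using R[of "if i then 1 else 2"] by (auto simp: M_def U_def split: if_splits)
      ultimately show False by blast
    qed
    then show ?thesis by (auto simp: M_def)
  qed
  then obtain A where A: "M 0 R A" "\<And>k. (R, \<Gamma> k R A) \<notin> COH" using R[of 0] by blast
  obtain i where i: "infinite {z. (z \<in> A) = (\<not> i)}"
  proof -
    have "{z. (z \<in> A) = (\<not> True)} \<union> {z. (z \<in> A) = (\<not> False)} = UNIV" by auto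
    then have "infinite ({z. (z \<in> A) = (\<not> True)} \<union> {z. (z \<in> A) = (\<not> False)})"
      by (simp only: infinite_UNIV_nat not_False_eq_True)
    then show thesis using that[of True] that[of False] unfolding finite_Un by blast
  qed
  \<comment> \<open>Since \<open>A\<close> is not bad, the side on which it is considered contains no infinite homogeneous set of
    the color opposite to \<open>i\<close>: on a finite part of it the algorithm would name a pair.\<close>
  have "\<exists>k. (R, \<Gamma> k R A) \<in> COH"
  proof (rule cohesive)
    show "infinite (res i (d 0 R) A [])" using i by (simp add: res_def)
    fix H assume H: "infinite H" "H \<subseteq> res i (d 0 R) A []"
    show "\<not> monochromatic (d 0 R) (\<not> i) H"
    proof
      assume mono: "monochromatic (d 0 R) (\<not> i) H"
      from sol[OF H(1) this] obtain Y0 where Y0: "O1 0 R H = join Y0 (right_part (O1 0 R H))" "infinite Y0" by blast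
      obtain x where x: "x \<in> Y0" using infinite_imp_nonempty[OF Y0(2)] by blast
      obtain y where y: "y \<in> Y0" "x < y" using Y0(2) by (auto simp: infinite_nat_iff_unbounded)
      have O1: "2 * x \<in> output q (join (X 0 R) H)" "2 * y \<in> output q (join (X 0 R) H)"
        using x y(1) Y0(1) unfolding O1_def by (metis join_even)+
      obtain u1 where u1: "\<And>Z. agree u1 (join (X 0 R) H) Z \<Longrightarrow> 2 * x \<in> output q Z" using output_open[OF O1(1)] by blast
      obtain u2 where u2: "\<And>Z. agree u2 (join (X 0 R) H) Z \<Longrightarrow> 2 * y \<in> output q Z" using output_open[OF O1(2)] by blast
      define u where "u = max u1 u2"
      define F where "F = H \<inter> {..<u}"
      have "bad R A"
        unfolding bad_def
      proof (intro exI conjI allI impI)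
        show "F \<subseteq> {..<u}" by (simp add: F_def)
        show "x < y" by (rule y(2))
        show "monochromatic (d 0 R) (\<not> i) F" using mono by (rule monochromatic_subset) (simp add: F_def)
        show "\<forall>f\<in>F. f \<in> A \<longleftrightarrow> (\<not> i)" using H(2) by (auto simp: F_def res_def)
        fix Z assume "agree u (join (X 0 R) F) Z"
        moreover have "agree u (join (X 0 R) H) (join (X 0 R) F)"
          by (rule agree_join) (auto simp: agree_def F_def)
        ultimately have Z: "agree u (join (X 0 R) H) Z" using agree_trans by blast
        show "2 * x \<in> output q Z" by (rule u1, rule agree_mono[OF Z]) (simp add: u_def)
        show "2 * y \<in> output q Z" by (rule u2, rule agree_mono[OF Z]) (simp add: u_def)
      qed
      then show False using A(1) by (simp add: M_def)
    qed
  qed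
  then show False using A(2) by blast
qed

section \<open>The reductions between the four problems\<close>

theorem corollary2p9:
  fixes S :: problem
  assumes "S \<in> SRT22 \<star>\<^sub>W COH"
  shows "SRT22 \<squnion>\<^sub>W COH \<le>\<^sub>W RT22
    \<and> RT22 \<le>\<^sub>W S
    \<and> SRT22 \<squnion>\<^sub>W COH \<le>\<^sub>W SRT22 \<times>\<^sub>W COH
    \<and> SRT22 \<times>\<^sub>W COH \<le>\<^sub>W S
    \<and> \<not> RT22 \<le>\<^sub>W SRT22 \<times>\<^sub>W COH
    \<and> \<not> SRT22 \<times>\<^sub>W COH \<le>\<^sub>W RT22
    \<and> \<not> RT22 \<le>\<^sub>W SRT22 \<squnion>\<^sub>W COH
    \<and> \<not> SRT22 \<times>\<^sub>W COH \<le>\<^sub>W SRT22 \<squnion>\<^sub>W COH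
    \<and> \<not> S \<le>\<^sub>W SRT22 \<squnion>\<^sub>W COH
    \<and> \<not> S \<le>\<^sub>W RT22
    \<and> \<not> S \<le>\<^sub>W SRT22 \<times>\<^sub>W COH"
proof -
  note positive = coproduct_le_RT22 RT22_le_compositional[OF assms]
    coproduct_le_product product_le_compositional[OF assms]
  \<comment> \<open>A reduction in the other direction along any of the remaining pairs would compose with
    one of the positive reductions to one of the two that are refuted.\<close>
  show ?thesis
    using positive RT22_not_le_product product_not_le_RT22 by (blast intro: weihrauch_trans)
qed

end
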